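(* Let $\Omega\subset\mathbb{R}^n$ be a smooth bounded open domain and let $\lambda_1$ be the first eigenvalue of $-\Delta$ in $W^{1,2}_0(\Omega)$. Fix boundary data $g_1,g_2$. Assume that for every $\lambda>-\lambda_1$ the pair $(u_\lambda,v_\lambda)\in W^{1,2}(\Omega)\times W^{1,2}(\Omega)$ solves $$\Delta u=(1+\lambda v)\chi_{\{u>0\}},\quad \Delta v=(1+\lambda u)\chi_{\{v>0\}},\quad u,v\ge0\ \text{ in }\Omega,\qquad u=g_1,\ v=g_2\ \text{ on }\partial\Omega.$$ Then, as $\lambda\to0$, there exist a sequence $\{(u_{\lambda_n},v_{\lambda_n})\}$ with $\lambda_n\ne0$, $\lim_{n\to\infty}\lambda_n=0$, and $(u_0,v_0)\in W^{1,2}(\Omega)\times W^{1,2}(\Omega)$ such that $u_{\lambda_n}\to u_0$ and $v_{\lambda_n}\to v_0$ in $W^{1,2}(\Omega)$, where $(u_0,v_0)$ is the solution of the classical obstacle problem $$\begin{cases}\Delta u=\chi_{\{u>0\}} & \text{in }\Omega,\\ \Delta v=\chi_{\{v>0\}} & \text{in }\Omega,\\ u,v\ge0 & \text{in }\Omega,\\ u=g_1,\ v=g_2 & \text{on }\partial\Omega.\end{cases}$$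
   Context: The data satisfy $g_1,g_2\in W^{1,2}(\Omega)$, $g_i\ge0$ on $\partial\Omega$ in the sense $g_i^-=\max\{-g_i,0\}\in W^{1,2}_0(\Omega)$, and $g_1,g_2\not\equiv0$. Equations are understood in the weak (distributional) sense, inequalities a.e., and boundary conditions in the sense $u-g_1,v-g_2\in W^{1,2}_0(\Omega)$. $\chi_E$ is the characteristic function of $E$. $\lambda_1=\inf_{\varphi\in W^{1,2}_0(\Omega)\setminus\{0\}}\int_\Omega|\nabla\varphi|^2dx\big/\int_\Omega|\varphi|^2dx$. *)

theory Defs
  imports "HOL-Analysis.Analysis"
begin

text \<open>Functions on \<open>\<Omega>\<close> are represented by total functions on the ambient space; only their
  values almost everywhere in \<open>\<Omega>\<close> matter, all integrals being taken over \<open>lebesgue_on \<Omega>\<close>.\<close>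

primrec Ck_on :: "nat \<Rightarrow> 'a::euclidean_space set \<Rightarrow> ('a \<Rightarrow> real) \<Rightarrow> bool" where
  "Ck_on 0 S f \<longleftrightarrow> continuous_on S f"
| "Ck_on (Suc k) S f \<longleftrightarrow>
     (\<forall>x\<in>S. f differentiable (at x)) \<and>
     (\<forall>h. Ck_on k S (\<lambda>x. frechet_derivative f (at x) h))"

definition smooth_on :: "'a::euclidean_space set \<Rightarrow> ('a \<Rightarrow> real) \<Rightarrow> bool" where
  "smooth_on S f \<longleftrightarrow> (\<forall>k. Ck_on k S f)"

text \<open>Locally, after relabelling and reorienting the coordinate axes (the choice of \<open>e\<close> and \<open>s\<close>),
  \<open>\<Omega>\<close> is the region on one side of the graph of a smooth function \<open>\<gamma>\<close> of the remaining
  coordinates; \<open>x - (x \<bullet> e) *\<^sub>R e\<close> is \<open>x\<close> with its \<open>e\<close>-coordinate deleted.\<close>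

definition smooth_boundary :: "'a::euclidean_space set \<Rightarrow> bool" where
  "smooth_boundary \<Omega> \<longleftrightarrow>
     (\<forall>p\<in>frontier \<Omega>. \<exists>r>0. \<exists>e\<in>Basis. \<exists>s\<in>{1, -1}. \<exists>\<gamma>. smooth_on UNIV \<gamma> \<and>
        \<Omega> \<inter> ball p r = {x \<in> ball p r. s * (x \<bullet> e) > \<gamma> (x - (x \<bullet> e) *\<^sub>R e)})"

definition smooth_bounded_domain :: "'a::euclidean_space set \<Rightarrow> bool" where
  "smooth_bounded_domain \<Omega> \<longleftrightarrow>
     open \<Omega> \<and> connected \<Omega> \<and> \<Omega> \<noteq> {} \<and> bounded \<Omega> \<and> smooth_boundary \<Omega>"

definition test_functions :: "'a::euclidean_space set \<Rightarrow> ('a \<Rightarrow> real) set" where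
  "test_functions \<Omega> =
     {\<phi>. smooth_on UNIV \<phi> \<and> (\<exists>K. compact K \<and> K \<subseteq> \<Omega> \<and> (\<forall>x. x \<notin> K \<longrightarrow> \<phi> x = 0))}"

definition L2 :: "'a::euclidean_space set \<Rightarrow> ('a \<Rightarrow> 'b::euclidean_space) set" where
  "L2 \<Omega> = {f. f \<in> borel_measurable (lebesgue_on \<Omega>) \<and>
              integrable (lebesgue_on \<Omega>) (\<lambda>x. (norm (f x))\<^sup>2)}"

definition has_weak_gradient ::
    "'a::euclidean_space set \<Rightarrow> ('a \<Rightarrow> real) \<Rightarrow> ('a \<Rightarrow> 'a) \<Rightarrow> bool" where
  "has_weak_gradient \<Omega> u G \<longleftrightarrow>
     (\<forall>\<phi>\<in>test_functions \<Omega>. \<forall>i\<in>Basis.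
        (LINT x|lebesgue_on \<Omega>. u x * frechet_derivative \<phi> (at x) i) =
        - (LINT x|lebesgue_on \<Omega>. (G x \<bullet> i) * \<phi> x))"

definition W12 :: "'a::euclidean_space set \<Rightarrow> ('a \<Rightarrow> real) set" where
  "W12 \<Omega> = {u. u \<in> L2 \<Omega> \<and> (\<exists>G\<in>L2 \<Omega>. has_weak_gradient \<Omega> u G)}"

text \<open>For \<open>u \<in> W12 \<Omega>\<close> the weak gradient is unique up to null sets, so the choice is immaterial.\<close>

definition weak_grad :: "'a::euclidean_space set \<Rightarrow> ('a \<Rightarrow> real) \<Rightarrow> 'a \<Rightarrow> 'a" where
  "weak_grad \<Omega> u = (SOME G. G \<in> L2 \<Omega> \<and> has_weak_gradient \<Omega> u G)"

definition W12_norm :: "'a::euclidean_space set \<Rightarrow> ('a \<Rightarrow> real) \<Rightarrow> real" where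
  "W12_norm \<Omega> u =
     sqrt ((LINT x|lebesgue_on \<Omega>. (u x)\<^sup>2) + (LINT x|lebesgue_on \<Omega>. (norm (weak_grad \<Omega> u x))\<^sup>2))"

definition W12_0 :: "'a::euclidean_space set \<Rightarrow> ('a \<Rightarrow> real) set" where
  "W12_0 \<Omega> = {u \<in> W12 \<Omega>. \<exists>\<phi>::nat \<Rightarrow> 'a \<Rightarrow> real.
      (\<forall>k. \<phi> k \<in> test_functions \<Omega>) \<and> (\<lambda>k. W12_norm \<Omega> (\<lambda>x. u x - \<phi> k x)) \<longlonglongrightarrow> 0}"

definition first_eigenvalue :: "'a::euclidean_space set \<Rightarrow> real" where
  "first_eigenvalue \<Omega> =
     Inf {(LINT x|lebesgue_on \<Omega>. (norm (weak_grad \<Omega> \<phi> x))\<^sup>2) / (LINT x|lebesgue_on \<Omega>. (\<phi> x)\<^sup>2) | \<phi>.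
          \<phi> \<in> W12_0 \<Omega> \<and> \<not> (AE x in lebesgue_on \<Omega>. \<phi> x = 0)}"

text \<open>The equation \<open>\<Delta>u = f\<close> in the weak sense for \<open>u \<in> W12 \<Omega>\<close>. The derivative of the test function
  \<open>\<phi>\<close> at \<open>x\<close>, applied to the vector \<open>\<nabla>u(x)\<close>, is the inner product of the two gradients.\<close>

definition weak_laplacian ::
    "'a::euclidean_space set \<Rightarrow> ('a \<Rightarrow> real) \<Rightarrow> ('a \<Rightarrow> real) \<Rightarrow> bool" where
  "weak_laplacian \<Omega> u f \<longleftrightarrow>
     (\<forall>\<phi>\<in>test_functions \<Omega>.
        - (LINT x|lebesgue_on \<Omega>. frechet_derivative \<phi> (at x) (weak_grad \<Omega> u x)) =
        (LINT x|lebesgue_on \<Omega>. f x * \<phi> x))"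

definition admissible_data :: "'a::euclidean_space set \<Rightarrow> ('a \<Rightarrow> real) \<Rightarrow> bool" where
  "admissible_data \<Omega> g \<longleftrightarrow>
     g \<in> W12 \<Omega> \<and> (\<lambda>x. max (- g x) 0) \<in> W12_0 \<Omega> \<and> \<not> (AE x in lebesgue_on \<Omega>. g x = 0)"

definition solves_system ::
    "'a::euclidean_space set \<Rightarrow> ('a \<Rightarrow> real) \<Rightarrow> ('a \<Rightarrow> real) \<Rightarrow> real \<Rightarrow>
     ('a \<Rightarrow> real) \<Rightarrow> ('a \<Rightarrow> real) \<Rightarrow> bool" where
  "solves_system \<Omega> g\<^sub>1 g\<^sub>2 l u v \<longleftrightarrow>
     u \<in> W12 \<Omega> \<and> v \<in> W12 \<Omega> \<and>
     weak_laplacian \<Omega> u (\<lambda>x. (1 + l * v x) * indicator {y. u y > 0} x) \<and>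
     weak_laplacian \<Omega> v (\<lambda>x. (1 + l * u x) * indicator {y. v y > 0} x) \<and>
     (AE x in lebesgue_on \<Omega>. u x \<ge> 0) \<and> (AE x in lebesgue_on \<Omega>. v x \<ge> 0) \<and>
     (\<lambda>x. u x - g\<^sub>1 x) \<in> W12_0 \<Omega> \<and> (\<lambda>x. v x - g\<^sub>2 x) \<in> W12_0 \<Omega>"

definition solves_obstacle ::
    "'a::euclidean_space set \<Rightarrow> ('a \<Rightarrow> real) \<Rightarrow> ('a \<Rightarrow> real) \<Rightarrow> bool" where
  "solves_obstacle \<Omega> g u \<longleftrightarrow>
     u \<in> W12 \<Omega> \<and> weak_laplacian \<Omega> u (indicator {y. u y > 0}) \<and>
     (AE x in lebesgue_on \<Omega>. u x \<ge> 0) \<and> (\<lambda>x. u x - g x) \<in> W12_0 \<Omega>"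

text \<open>Uniqueness is that of elements of \<open>W12 \<Omega>\<close>, i.e. up to null sets.\<close>

definition is_the_obstacle_solution ::
    "'a::euclidean_space set \<Rightarrow> ('a \<Rightarrow> real) \<Rightarrow> ('a \<Rightarrow> real) \<Rightarrow> bool" where
  "is_the_obstacle_solution \<Omega> g u \<longleftrightarrow>
     solves_obstacle \<Omega> g u \<and>
     (\<forall>w. solves_obstacle \<Omega> g w \<longrightarrow> (AE x in lebesgue_on \<Omega>. w x = u x))"

end

theory Submission
  imports Defs
begin

text \<open>Since \<open>\<lambda>\<^sub>1 > 0\<close>, the hypothesis applies at \<open>\<lambda> = 0\<close>, where the system decouples into two obstacle
  problems; so \<open>(u\<^sub>0, v\<^sub>0)\<close> is the limit. The difference \<open>w = u\<^sub>\<lambda> - u\<^sub>0\<close> lies in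
  \<open>W\<^sup>1\<^sup>,\<^sup>2\<^sub>0\<close> and may be used as a test function. The map \<open>u \<mapsto> \<chi>\<close> of \<open>{u > 0}\<close> is monotone on
  \<open>u \<ge> 0\<close>, so this leaves \<open>\<integral>|\<nabla>w|\<^sup>2 \<le> |\<lambda>| \<integral>|v\<^sub>\<lambda>| |w|\<close>, and symmetrically
  for \<open>z = v\<^sub>\<lambda> - v\<^sub>0\<close>. By Young's and Poincare's inequalities the sum of the two energies is
  \<open>O(|\<lambda>|)\<close>. The same estimate with \<open>\<lambda> = 0\<close> gives uniqueness. Poincare's inequality for a test
  function \<open>\<phi>\<close> comes from integrating \<open>\<partial>\<^sub>i (x\<^sub>i \<phi>\<^sup>2)\<close>.\<close>

subsection \<open>Smooth functions and bump functions\<close>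

text \<open>The obstacle in the energy estimate is that \<open>v l\<close> stands on its right-hand
  side without any a priori bound. Writing \<open>v l\<close> as \<open>(v l - v 0) + v 0\<close>
  and using Poincare's inequality replaces it by the energy of \<open>v l - v 0\<close> plus the
  fixed norm of \<open>v 0\<close>. When the two symmetric estimates are added, the unknown energies
  carry the total coefficient \<open>3 * K * \<bar>l\<bar> / 2\<close>; they are absorbed on the
  left once \<open>3 * K * \<bar>l\<bar> \<le> 1\<close>, and this dictates the choice of the
  sequence.

  A second obstacle is that \<open>weak_grad\<close> is an arbitrary choice: it need not be linear,
  nor agree pointwise with the classical gradient of a test function. Such identities hold only
  almost everywhere and all rest on the uniqueness of weak gradients, hence on the fundamental lemma
  of the calculus of variations. That lemma needs explicit compactly supported smooth functions,
  built here from \<open>exp (- (1 / t))\<close>. The same functions show that the infimum in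
  \<open>first_eigenvalue\<close> runs over a nonempty set.\<close>

lemma Ck_on_SucD: "Ck_on (Suc k) UNIV f \<Longrightarrow> Ck_on k UNIV f"
proof (induction k arbitrary: f)
  case 0
  then show ?case
    by (auto intro!: differentiable_imp_continuous_on simp: differentiable_on_def)
next
  case (Suc k)
  then show ?case
    by (metis Ck_on.simps(2))
qed

lemma Ck_on_const: "Ck_on k UNIV (\<lambda>_. c)"
  by (induction k arbitrary: c) auto

lemma frechet_derivative_add':
  assumes "f differentiable (at x)" "g differentiable (at x)"
  shows "frechet_derivative (\<lambda>x. f x + g x) (at x) h =
    frechet_derivative f (at x) h + frechet_derivative g (at x) h"
proof -
  have "((\<lambda>x. f x + g x) has_derivative
      (\<lambda>h. frechet_derivative f (at x) h + frechet_derivative g (at x) h)) (at x)"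
    using assms by (intro has_derivative_add) (simp_all add: frechet_derivative_works[symmetric])
  then show ?thesis
    by (metis frechet_derivative_at)
qed

lemma Ck_on_add:
  assumes "Ck_on k UNIV f" "Ck_on k UNIV g"
  shows "Ck_on k UNIV (\<lambda>x. f x + g x)"
  using assms
proof (induction k arbitrary: f g)
  case 0
  then show ?case by (simp add: continuous_on_add)
next
  case (Suc k)
  then show ?case
    by (simp add: frechet_derivative_add')
qed

lemma frechet_derivative_mult':
  fixes f g :: "'a::real_normed_vector \<Rightarrow> real"
  assumes "f differentiable (at x)" "g differentiable (at x)"
  shows "frechet_derivative (\<lambda>x. f x * g x) (at x) h =
    f x * frechet_derivative g (at x) h + frechet_derivative f (at x) h * g x"
proof -
  have "((\<lambda>x. f x * g x) has_derivative
      (\<lambda>h. f x * frechet_derivative g (at x) h + frechet_derivative f (at x) h * g x)) (at x)"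
    using assms by (intro has_derivative_mult) (simp_all add: frechet_derivative_works[symmetric])
  then show ?thesis
    by (metis frechet_derivative_at)
qed

lemma Ck_on_mult:
  assumes "Ck_on k UNIV f" "Ck_on k UNIV g"
  shows "Ck_on k UNIV (\<lambda>x. f x * g x)"
  using assms
proof (induction k arbitrary: f g)
  case 0
  then show ?case by (simp add: continuous_on_mult)
next
  case (Suc k)
  show ?case
    using Suc.prems Ck_on_SucD[OF Suc.prems(1)] Ck_on_SucD[OF Suc.prems(2)]
    by (simp add: frechet_derivative_mult' Ck_on_add Suc.IH)
qed

lemma smooth_on_continuous: "smooth_on UNIV f \<Longrightarrow> continuous_on UNIV f"
  unfolding smooth_on_def by (metis Ck_on.simps(1))

lemma smooth_on_differentiable: "smooth_on UNIV f \<Longrightarrow> f differentiable (at x)"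
  unfolding smooth_on_def by (metis Ck_on.simps(2) UNIV_I)

lemma smooth_on_frechet_derivative:
  "smooth_on UNIV f \<Longrightarrow> smooth_on UNIV (\<lambda>x. frechet_derivative f (at x) h)"
  unfolding smooth_on_def by (metis Ck_on.simps(2))

lemma smooth_on_borel_measurable: "smooth_on UNIV f \<Longrightarrow> f \<in> borel_measurable borel"
  by (intro borel_measurable_continuous_onI smooth_on_continuous)

lemma smooth_on_mult: "smooth_on UNIV f \<Longrightarrow> smooth_on UNIV g \<Longrightarrow> smooth_on UNIV (\<lambda>x. f x * g x)"
  by (auto simp: smooth_on_def Ck_on_mult)

lemma smooth_on_diff:
  assumes "smooth_on UNIV f" "smooth_on UNIV g"
  shows "smooth_on UNIV (\<lambda>x. f x - g x)"
proof -
  have "Ck_on k UNIV (\<lambda>x. f x + (-1) * g x)" for k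
    using assms unfolding smooth_on_def by (intro Ck_on_add Ck_on_mult Ck_on_const) auto
  then show ?thesis by (simp add: smooth_on_def)
qed

lemma smooth_on_prod:
  assumes "finite I" "\<And>i. i \<in> I \<Longrightarrow> smooth_on UNIV (f i)"
  shows "smooth_on UNIV (\<lambda>x. \<Prod>i\<in>I. f i x)"
  using assms
  by (induction I rule: finite_induct) (auto simp: smooth_on_mult, simp add: smooth_on_def Ck_on_const)

text \<open>The derivative of \<open>flat n\<close> is a combination of \<open>flat (n + 1)\<close> and \<open>flat (n + 2)\<close>, so the whole
  family is shown to be smooth by one induction.\<close>

definition flat :: "nat \<Rightarrow> real \<Rightarrow> real" where
  "flat n t = (if t > 0 then exp (- (1 / t)) / t ^ n else 0)"

text \<open>With \<open>s = 1 / t\<close>, the right-hand limit is the decay of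
  \<open>s ^ n / exp s\<close> as s grows; to the left of 0 the function is identically
  zero.\<close>

lemma flat_tendsto_0: "((flat n) \<longlongrightarrow> 0) (at 0)"
proof -
  have "((\<lambda>t. (1/t) ^ n / exp (1/t)) \<longlongrightarrow> 0) (at_right (0::real))"
    by (rule filterlim_compose[OF tendsto_power_div_exp_0])
       (simp add: divide_inverse filterlim_inverse_at_top_right)
  moreover have "\<forall>\<^sub>F t in at_right 0. (1/t) ^ n / exp (1/t) = flat n t"
    unfolding eventually_at_right_field
    by (intro exI[of _ 1]) (simp add: flat_def exp_minus power_one_over divide_inverse power_inverse)
  ultimately have "(flat n \<longlongrightarrow> 0) (at_right 0)"
    by (rule Lim_transform_eventually)
  moreover have "(flat n \<longlongrightarrow> 0) (at_left 0)"
    by (rule tendsto_eventually) (auto simp: eventually_at_left_field flat_def intro!: exI[of _ "-1"])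
  ultimately show ?thesis
    by (simp add: filterlim_split_at)
qed

lemma flat_has_derivative:
  "(flat n has_real_derivative flat (n + 2) t - real n * flat (n + 1) t) (at t)"
proof -
  consider "t > 0" | "t < 0" | "t = 0" by linarith
  then show ?thesis
  proof cases
    case 1
    have "((\<lambda>t. exp (- (1 / t)) / t ^ n) has_real_derivative
        flat (n + 2) t - real n * flat (n + 1) t) (at t)"
      using 1
      by (auto intro!: derivative_eq_intros simp: flat_def field_simps power2_eq_square)
         (cases n; simp)
    then show ?thesis
      by (rule has_field_derivative_transform_within_open[of _ _ _ "{0<..}"])
         (use 1 in \<open>auto simp: flat_def\<close>)
  next
    case 2
    have "((\<lambda>t. 0) has_real_derivative flat (n + 2) t - real n * flat (n + 1) t) (at t)"
      using 2 by (auto simp: flat_def)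
    then show ?thesis
      by (rule has_field_derivative_transform_within_open[of _ _ _ "{..<0}"])
         (use 2 in \<open>auto simp: flat_def\<close>)
  next
    case 3
    \<comment> \<open>Dividing \<open>flat n y\<close> by \<open>y\<close> gives
      \<open>flat (Suc n) y\<close>, so the difference quotient at 0 is covered by the limit already
      computed for the next index.\<close>
    have "((\<lambda>y. (flat n y - flat n 0) / (y - 0)) \<longlongrightarrow> 0) (at 0)"
      using flat_tendsto_0[of "Suc n"]
      by (rule Lim_transform_eventually) (auto simp: flat_def eventually_at_filter)
    then show ?thesis
      by (simp add: has_field_derivative_iff 3 flat_def)
  qed
qed

text \<open>The affine argument is the form in which \<open>bump\<close> uses the family. The inner
  derivative \<open>c * (h \<bullet> e)\<close> is constant in \<open>x\<close>, so a directional
  derivative stays a linear combination of members of the family.\<close>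

lemma smooth_on_flat:
  fixes e :: "'a::euclidean_space"
  shows "smooth_on UNIV (\<lambda>x. flat n (c * (x \<bullet> e) + d))"
proof -
  have der: "((\<lambda>x. flat n (c * (x \<bullet> e) + d)) has_derivative
      (\<lambda>h. (c * (h \<bullet> e)) * (flat (n + 2) (c * (x \<bullet> e) + d)
         + (- real n) * flat (n + 1) (c * (x \<bullet> e) + d)))) (at x)" for n and x :: 'a
  proof -
    have "((\<lambda>x. c * (x \<bullet> e) + d) has_derivative (\<lambda>h. c * (h \<bullet> e))) (at x)"
      by (auto intro!: derivative_eq_intros)
    from has_derivative_compose[OF this flat_has_derivative[unfolded has_field_derivative_def]]
    show ?thesis by (simp add: o_def algebra_simps)
  qed
  then have diff: "(\<lambda>x. flat n (c * (x \<bullet> e) + d)) differentiable (at x)" for n and x :: 'a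
    unfolding differentiable_def by blast
  have "Ck_on k UNIV (\<lambda>x. flat n (c * (x \<bullet> e) + d))" for k
  proof (induction k arbitrary: n)
    case 0
    show ?case
      by (auto intro!: differentiable_imp_continuous_on simp: differentiable_on_def diff)
  next
    case (Suc k)
    have "Ck_on k UNIV (\<lambda>x. (c * (h \<bullet> e)) * (flat (n + 2) (c * (x \<bullet> e) + d)
         + (- real n) * flat (n + 1) (c * (x \<bullet> e) + d)))" for h
      by (intro Ck_on_mult Ck_on_add Ck_on_const Suc)
    moreover have "frechet_derivative (\<lambda>x. flat n (c * (x \<bullet> e) + d)) (at x) =
      (\<lambda>h. (c * (h \<bullet> e)) * (flat (n + 2) (c * (x \<bullet> e) + d)
         + (- real n) * flat (n + 1) (c * (x \<bullet> e) + d)))" for x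
      using frechet_derivative_at[OF der] by simp
    ultimately show ?case by (simp add: diff)
  qed
  then show ?thesis by (simp add: smooth_on_def)
qed

text \<open>Each coordinate contributes two factors that vanish unless it lies strictly between
  those of \<open>a\<close> and \<open>b\<close>. The parameter \<open>m\<close> steepens the
  flanks: as it grows, the functions tend to the indicator of the open box while staying between 0
  and 1. The arguments are spelled as \<open>c * (x \<bullet> e) + d\<close> to match
  \<open>smooth_on_flat\<close>.\<close>

definition bump :: "'a::euclidean_space \<Rightarrow> 'a \<Rightarrow> nat \<Rightarrow> 'a \<Rightarrow> real" where
  "bump a b m x = (\<Prod>i\<in>Basis. flat 0 (real m * (x \<bullet> i) + - real m * (a \<bullet> i)) *
                              flat 0 (- real m * (x \<bullet> i) + real m * (b \<bullet> i)))"

lemma bump_eq_0: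
  assumes x: "x \<notin> box a b"
  shows "bump a b m x = 0"
proof -
  obtain i where i: "i \<in> Basis" "x \<bullet> i \<le> a \<bullet> i \<or> b \<bullet> i \<le> x \<bullet> i"
    using x unfolding mem_box by (meson not_le)
  have "real m * (x \<bullet> i) + - real m * (a \<bullet> i) \<le> 0 \<or> - real m * (x \<bullet> i) + real m * (b \<bullet> i) \<le> 0"
    using i(2) by (auto simp: mult_left_mono)
  then show ?thesis
    unfolding bump_def using i(1)
    by (intro prod_zero finite_Basis bexI[of _ i]) (auto simp: flat_def)
qed

lemma smooth_on_bump: "smooth_on UNIV (bump a b m)"
  unfolding bump_def by (intro smooth_on_prod smooth_on_mult smooth_on_flat) auto

lemma bump_test_function: "cbox a b \<subseteq> \<Omega> \<Longrightarrow> bump a b m \<in> test_functions \<Omega>"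
  using box_subset_cbox smooth_on_bump unfolding test_functions_def
  by (fastforce intro!: exI[of _ "cbox a b"] bump_eq_0)

lemma flat_0_bounds: "0 \<le> flat 0 t" "flat 0 t \<le> 1"
  by (auto simp: flat_def)

lemma bump_bounds: "0 \<le> bump a b m x" "bump a b m x \<le> 1"
  unfolding bump_def
  by (auto intro!: prod_nonneg prod_le_1 mult_nonneg_nonneg mult_le_one flat_0_bounds)

lemma bump_pos: "x \<in> box a b \<Longrightarrow> 0 < bump a b 1 x"
  unfolding bump_def by (intro prod_pos) (auto simp: flat_def mem_box)

lemma bump_tendsto: "(\<lambda>m. bump a b m x) \<longlonglongrightarrow> indicator (box a b) x"
proof -
  have pos: "(\<lambda>m. flat 0 (real m * t)) \<longlonglongrightarrow> 1" if "t > 0" for t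
  proof -
    have "(\<lambda>m. exp (- (inverse (real m) * (1 / t)))) \<longlonglongrightarrow> exp (- (0 * (1/t)))"
      by (intro tendsto_intros lim_inverse_n)
    \<comment> \<open>Only eventually: at \<open>m = 0\<close> the left side is 1 because
      \<open>inverse 0 = 0\<close>, whereas \<open>flat 0 0 = 0\<close>.\<close>
    moreover have "\<forall>\<^sub>F m in sequentially. exp (- (inverse (real m) * (1 / t))) = flat 0 (real m * t)"
      using eventually_gt_at_top[of 0] by eventually_elim (use that in \<open>auto simp: flat_def field_simps\<close>)
    ultimately show ?thesis by (auto intro: Lim_transform_eventually)
  qed
  have lim: "(\<lambda>m. flat 0 (real m * t)) \<longlonglongrightarrow> (if t > 0 then 1 else 0)" for t
    using pos by (auto simp: flat_def zero_less_mult_iff)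
  have "(\<lambda>m. \<Prod>i\<in>Basis. flat 0 (real m * (x \<bullet> i - a \<bullet> i)) * flat 0 (real m * (b \<bullet> i - x \<bullet> i)))
     \<longlonglongrightarrow> (\<Prod>i\<in>Basis. (if x \<bullet> i - a \<bullet> i > 0 then 1 else 0) * (if b \<bullet> i - x \<bullet> i > 0 then 1 else 0))"
    by (intro tendsto_prod tendsto_mult lim)
  moreover have "(\<Prod>i\<in>Basis. (if x \<bullet> i - a \<bullet> i > 0 then 1 else 0) * (if b \<bullet> i - x \<bullet> i > 0 then 1 else 0))
      = (indicator (box a b) x :: real)"
  proof (cases "x \<in> box a b")
    case True
    then show ?thesis by (intro prod.neutral[THEN trans]) (auto simp: mem_box)
  next
    case False
    then obtain i where "i \<in> Basis" "\<not> (a \<bullet> i < x \<bullet> i \<and> x \<bullet> i < b \<bullet> i)"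
      by (auto simp: mem_box)
    then have "(\<Prod>i\<in>Basis. (if x \<bullet> i - a \<bullet> i > 0 then 1 else 0) * (if b \<bullet> i - x \<bullet> i > 0 then 1 else 0)) = (0::real)"
      by (intro prod_zero finite_Basis bexI[of _ i]) auto
    with False show ?thesis by simp
  qed
  ultimately show ?thesis
    by (simp add: bump_def algebra_simps)
qed

subsection \<open>Integration by parts and the fundamental lemma\<close>

text \<open>Translation invariance makes the integral of every difference quotient vanish.\<close>

lemma integral_partial_derivative_eq_0:
  fixes h :: "'a::euclidean_space \<Rightarrow> real"
  assumes der: "\<And>x. (h has_derivative h' x) (at x)"
    and cont: "continuous_on UNIV (\<lambda>x. h' x i)"
    and i: "i \<in> Basis" and K: "compact K" and zero: "\<And>x. x \<notin> K \<Longrightarrow> h x = 0"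
  shows "(LINT x|lborel. h' x i) = 0"
proof -
  have hcont: "continuous_on UNIV h"
    by (intro continuous_at_imp_continuous_on ballI has_derivative_continuous[OF der])
  have [measurable]: "h \<in> borel_measurable borel" "(\<lambda>x. h' x i) \<in> borel_measurable borel"
    using hcont cont by (auto intro: borel_measurable_continuous_onI)
  have h'0: "h' x i = 0" if "x \<notin> K" for x
  proof -
    have "((\<lambda>_. 0) has_derivative h' x) (at x)"
      using der[of x] by (rule has_derivative_transform_within_open[of _ _ _ _ "- K"])
        (use K that zero in \<open>auto simp: compact_imp_closed\<close>)
    then have "h' x = (\<lambda>_. 0)"
      using has_derivative_const has_derivative_unique by blast
    then show ?thesis by simp
  qed
  obtain R where R: "\<And>x. x \<in> K \<Longrightarrow> norm x \<le> R"
    using compact_imp_bounded[OF K] by (auto simp: bounded_iff)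
  obtain B0 where "\<And>x. x \<in> K \<Longrightarrow> norm (h' x i) \<le> B0"
    using compact_imp_bounded[OF compact_continuous_image[OF continuous_on_subset[OF cont] K]]
    by (auto simp: bounded_iff)
  \<comment> \<open>If \<open>K\<close> is empty, nothing prevents \<open>B0\<close> from being
    negative, hence the maximum with 0.\<close>
  with h'0 have B: "\<bar>h' x i\<bar> \<le> max B0 0" for x
    by (cases "x \<in> K") (auto simp: le_max_iff_disj)
  have der1: "((\<lambda>t. h (x + t *\<^sub>R i)) has_real_derivative h' (x + t *\<^sub>R i) i) (at t)" for x t
  proof -
    have "((\<lambda>t. x + t *\<^sub>R i) has_derivative (\<lambda>s. s *\<^sub>R i)) (at t)"
      by (auto intro!: derivative_eq_intros)
    from has_derivative_compose[OF this der]
    have "((\<lambda>t. h (x + t *\<^sub>R i)) has_derivative (\<lambda>s. h' (x + t *\<^sub>R i) (s *\<^sub>R i))) (at t)" .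
    moreover have "h' y (s *\<^sub>R i) = h' y i * s" for s y
      using linear_cmul[OF has_derivative_linear[OF der[of y]]] by simp
    ultimately show ?thesis
      by (simp add: has_field_derivative_def)
  qed
  define q where "q n x = real (Suc n) * (h (x + (1 / real (Suc n)) *\<^sub>R i) - h x)" for n x
  \<comment> \<open>Steps of the difference quotients have length at most 1, so outside the ball of
    radius \<open>R + 1\<close> both evaluation points miss \<open>K\<close> and the quotient
    vanishes. Inside, the mean value theorem along \<open>i\<close> bounds it by the supremum of the
    derivative. Together these give an integrable majorant.\<close>
  define K' where "K' = cball (0::'a) (R + 1)"
  have q_lim: "(\<lambda>n. q n x) \<longlonglongrightarrow> h' x i" for x
  proof -
    have "((\<lambda>t. (h (x + t *\<^sub>R i) - h x) / t) \<longlongrightarrow> h' x i) (at 0)"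
      using der1[of x 0] by (simp add: has_field_derivative_iff)
    then have "(\<lambda>n. (h (x + (1 / real (Suc n)) *\<^sub>R i) - h x) / (1 / real (Suc n))) \<longlonglongrightarrow> h' x i"
      by (rule filterlim_compose)
        (use LIMSEQ_Suc[OF lim_1_over_n] in \<open>auto simp: filterlim_at\<close>)
    then show ?thesis by (simp add: q_def mult.commute)
  qed
  have q_bound: "norm (q n x) \<le> max B0 0 * indicator K' x" for n x
  proof (cases "x \<in> K'")
    case True
    obtain z where "h (x + (1 / real (Suc n)) *\<^sub>R i) - h (x + 0 *\<^sub>R i)
        = (1 / real (Suc n) - 0) * h' (x + z *\<^sub>R i) i"
      using MVT2[of 0 "1 / real (Suc n)" "\<lambda>t. h (x + t *\<^sub>R i)"] der1 by force
    then have "q n x = h' (x + z *\<^sub>R i) i"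
      by (simp add: q_def)
    with B True show ?thesis by simp
  next
    case False
    then have x: "norm x > R + 1" by (simp add: K'_def)
    have "norm ((1 / real (Suc n)) *\<^sub>R i) \<le> 1" using i by simp
    moreover have "norm x \<le> norm (x + (1 / real (Suc n)) *\<^sub>R i) + norm ((1 / real (Suc n)) *\<^sub>R i)"
      by (metis add_diff_cancel_right' norm_triangle_ineq4)
    ultimately have "norm (x + (1 / real (Suc n)) *\<^sub>R i) > R" using x by linarith
    moreover have "norm x > R" using x by simp
    ultimately have "x \<notin> K" "x + (1 / real (Suc n)) *\<^sub>R i \<notin> K"
      using R by (meson not_le)+
    then show ?thesis by (simp add: q_def zero False)
  qed
  have "emeasure lborel K' < \<infinity>"
    unfolding K'_def by (rule emeasure_bounded_finite) simp
  then have wint: "integrable lborel (\<lambda>x. max B0 0 * indicator K' x)"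
    unfolding K'_def by (intro integrable_mult_right integrable_real_indicator)
      auto
  have [measurable]: "q n \<in> borel_measurable borel" for n
    unfolding q_def by measurable
  have "(\<lambda>n. LINT x|lborel. q n x) \<longlonglongrightarrow> (LINT x|lborel. h' x i)"
    by (rule integral_dominated_convergence[OF _ _ wint]) (use q_lim q_bound in simp_all)
  moreover have "(LINT x|lborel. q n x) = 0" for n
  proof -
    obtain B1 where B1: "\<And>x. x \<in> K \<Longrightarrow> norm (h x) \<le> B1"
      using compact_imp_bounded[OF compact_continuous_image[OF continuous_on_subset[OF hcont] K]]
      by (auto simp: bounded_iff)
    have Kb: "K \<in> sets borel" using K by (simp add: borel_compact)
    have hint: "integrable lborel h"
    proof (rule Bochner_Integration.integrable_bound)
      show "integrable lborel (\<lambda>x. B1 * indicator K x)"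
        using K Kb emeasure_bounded_finite[OF compact_imp_bounded[OF K]]
        by (intro integrable_mult_right integrable_real_indicator) auto
      show "AE x in lborel. norm (h x) \<le> norm (B1 * indicator K x)"
        using B1 zero by (intro AE_I2) (fastforce simp: indicator_def intro: order_trans)
    qed simp
    have eq: "distr lborel borel ((+) c) = lborel" for c :: 'a by (rule lborel_distr_plus)
    have "integrable lborel (\<lambda>x. h (x + c))" for c
      using integrable_distr[of "(+) c" lborel borel h] hint by (simp add: eq add.commute)
    moreover have "(LINT x|lborel. h (x + c)) = (LINT x|lborel. h x)" for c
      using integral_distr[of "(+) c" lborel borel h] by (simp add: eq add.commute)
    ultimately show ?thesis
      using hint unfolding q_def by (simp add: Bochner_Integration.integral_diff)
  qed
  ultimately show ?thesis
    by (simp add: LIMSEQ_const_iff)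
qed

text \<open>A Dynkin system argument: open boxes are stable under intersection and generate the
  Borel sets, so the integral of \<open>f\<close> vanishes over every Borel set. The complement step
  needs the integral over the whole space, which is zero by exhausting the space with growing
  boxes.\<close>

lemma AE_eq_0_of_box_integrals:
  fixes f :: "'a::euclidean_space \<Rightarrow> real"
  assumes f: "integrable lborel f"
    and box: "\<And>c d. (LINT x|lborel. indicator (box c d) x * f x) = 0"
  shows "AE x in lborel. f x = 0"
proof (rule sigma_finite_measure.density_zero[OF sigma_finite_lborel f])
  fix A :: "'a set" assume "A \<in> sets lborel"
  then have A: "A \<in> sigma_sets UNIV (range (\<lambda>(a, b). box a b))"
    by (simp add: borel_eq_box)
  have sets: "\<And>A. A \<in> sigma_sets UNIV (range (\<lambda>(a, b). box a b)) \<Longrightarrow> A \<in> sets (borel::'a measure)"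
    by (simp add: borel_eq_box)
  have fi: "set_integrable lborel A f" if "A \<in> sets borel" for A
    using f that unfolding set_integrable_def
    by (intro integrable_mult_indicator) simp_all
  have all: "(LINT x|lborel. f x) = 0"
  proof -
    have lim: "(\<lambda>n. LINT x|lborel. indicator (box (- real n *\<^sub>R One) (real n *\<^sub>R One)) x * f x)
        \<longlonglongrightarrow> (LINT x|lborel. f x)"
    proof (rule integral_dominated_convergence[where w = "\<lambda>x. norm (f x)"])
      show "AE x in lborel. (\<lambda>n. indicator (box (- real n *\<^sub>R One) (real n *\<^sub>R One)) x * f x) \<longlonglongrightarrow> f x"
      proof (intro AE_I2 tendsto_eventually)
        fix x :: 'a
        have "x \<in> box (- real n *\<^sub>R One) (real n *\<^sub>R One)" if "norm x < real n" for n
          using that Basis_le_norm[of _ x] by (fastforce simp: mem_box abs_less_iff)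
        note mem = this
        have "\<forall>\<^sub>F n in sequentially. norm x < real n"
          by (rule eventually_at_top_linorderI[of "nat \<lceil>norm x\<rceil> + 1"]) linarith
        then show "\<forall>\<^sub>F n in sequentially. indicator (box (- real n *\<^sub>R One) (real n *\<^sub>R One)) x * f x = f x"
          by eventually_elim (simp only: indicator_simps mem mult_1)
      qed
    qed (use f in \<open>auto simp: indicator_def\<close>)
    then show ?thesis by (simp add: box LIMSEQ_const_iff)
  qed
  have "Int_stable (range (\<lambda>(a, b). box a b :: 'a set))"
    by (auto simp: Int_stable_def box_Int_box)
  from this subset_UNIV[of "range (\<lambda>(a, b). box a b)", folded Pow_UNIV] A
  show "set_lebesgue_integral lborel A f = 0"
  proof (induction rule: sigma_sets_induct_disjoint)
    case (basic A)
    then show ?case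
      by (auto simp: set_lebesgue_integral_def box)
  next
    case (compl A)
    have "set_lebesgue_integral lborel (UNIV - A) f
        = (LINT x|lborel. f x) - set_lebesgue_integral lborel A f"
    proof -
      have "(\<lambda>x. indicator (UNIV - A) x *\<^sub>R f x) = (\<lambda>x. f x - indicator A x *\<^sub>R f x)"
        by (auto simp: indicator_def)
      then show ?thesis
        using f fi[OF sets[OF compl(1)]]
        by (simp add: set_lebesgue_integral_def set_integrable_def del: real_scaleR_def)
    qed
    with compl all show ?case by simp
  next
    case (union A)
    have "set_lebesgue_integral lborel (\<Union>i. A i) f = (\<Sum>i. set_lebesgue_integral lborel (A i) f)"
    proof -
      have A: "A i \<in> sets borel" for i
        using union.hyps by (intro sets) auto
      show ?thesis
        using union.hyps
        by (intro lebesgue_integral_countable_add fi sets.countable_UN) (auto simp: disjoint_family_on_def A)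
    qed
    with union show ?case by simp
  qed (auto simp: set_lebesgue_integral_def)
qed

text \<open>The indicator of a subbox is the bounded pointwise limit of bump functions, and these
  are test functions because the closed box \<open>cbox a b\<close> lies in \<open>\<Omega>\<close>.
  Dominated convergence therefore carries the vanishing of test integrals over to box
  integrals.\<close>

lemma AE_eq_0_on_box_of_test_integrals:
  fixes f :: "'a::euclidean_space \<Rightarrow> real"
  assumes f: "integrable lborel (\<lambda>x. indicator (box a b) x * f x)"
    and ab: "cbox a b \<subseteq> \<Omega>"
    and test: "\<And>\<phi>. \<phi> \<in> test_functions \<Omega> \<Longrightarrow> (LINT x|lborel. f x * \<phi> x) = 0"
  shows "AE x in lborel. indicator (box a b) x * f x = 0"
proof (rule AE_eq_0_of_box_integrals[OF f])
  fix c d :: 'a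
  obtain p q where pq: "box c d \<inter> box a b = box p q"
    by (auto simp: box_Int_box)
  have eq: "(LINT x|lborel. indicator (box c d) x * (indicator (box a b) x * f x))
     = (LINT x|lborel. indicator (box p q) x * f x)"
    unfolding pq[symmetric]
    by (rule Bochner_Integration.integral_cong) (auto simp: indicator_def)
  show "(LINT x|lborel. indicator (box c d) x * (indicator (box a b) x * f x)) = 0"
  \<comment> \<open>A nonempty open box has \<open>cbox p q\<close> as its closure, which then stays
    inside \<open>cbox a b\<close>. An empty one may belong to a degenerate closed box that leaves
    \<open>\<Omega>\<close>, so it is treated apart.\<close>
  proof (cases "box p q = {}")
    case True
    then show ?thesis by (simp add: eq)
  next
    case False
    have sub: "box p q \<subseteq> box a b" using pq by blast
    then have "cbox p q \<subseteq> cbox a b"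
      using False by (metis closure_box closure_mono box_eq_empty(1) subset_empty)
    then have tf: "bump p q m \<in> test_functions \<Omega>" for m
      using ab by (intro bump_test_function) auto
    have [measurable]: "bump p q m \<in> borel_measurable borel" for m
      by (intro smooth_on_borel_measurable smooth_on_bump)
    have fm: "f' \<in> borel_measurable lborel" if "integrable lborel f'" for f' :: "'a \<Rightarrow> real"
      using that by auto
    \<comment> \<open>The bump already vanishes off \<open>box a b\<close>, so \<open>f\<close> may
      be replaced by its truncation, which is the function known to be integrable.\<close>
    have ind: "bump p q m x * f x = bump p q m x * (indicator (box a b) x * f x)" for m x
      using bump_eq_0[of x p q m] sub by (cases "x \<in> box p q") auto
    have "(\<lambda>m. LINT x|lborel. bump p q m x * (indicator (box a b) x * f x)) \<longlonglongrightarrow>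
       (LINT x|lborel. indicator (box p q) x * (indicator (box a b) x * f x))"
    proof (rule integral_dominated_convergence[where w = "\<lambda>x. norm (indicator (box a b) x * f x)"])
      show "AE x in lborel. norm (bump p q m x * (indicator (box a b) x * f x))
          \<le> norm (indicator (box a b) x * f x)" for m
        by (intro AE_I2) (simp add: abs_mult mult_left_le_one_le bump_bounds)
      show "AE x in lborel. (\<lambda>m. bump p q m x * (indicator (box a b) x * f x))
          \<longlonglongrightarrow> indicator (box p q) x * (indicator (box a b) x * f x)"
        by (intro AE_I2 tendsto_mult bump_tendsto tendsto_const)
    qed (use f fm[OF f] in auto)
    moreover have "(LINT x|lborel. bump p q m x * (indicator (box a b) x * f x)) = 0" for m
      unfolding ind[symmetric] using test[OF tf[of m]] by (simp add: mult.commute)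
    moreover have "(LINT x|lborel. indicator (box p q) x * (indicator (box a b) x * f x))
        = (LINT x|lborel. indicator (box p q) x * f x)"
      using sub by (intro Bochner_Integration.integral_cong) (auto simp: indicator_def)
    ultimately show ?thesis
      by (simp add: eq LIMSEQ_const_iff)
  qed
qed

text \<open>The fundamental lemma of the calculus of variations, reduced to closed boxes inside
  \<open>\<Omega>\<close>.\<close>

lemma AE_eq_0_of_test_integrals:
  fixes f :: "'a::euclidean_space \<Rightarrow> real"
  assumes \<Omega>: "open \<Omega>" and f: "f \<in> L2 \<Omega>"
    and test: "\<And>\<phi>. \<phi> \<in> test_functions \<Omega> \<Longrightarrow> (LINT x|lebesgue_on \<Omega>. f x * \<phi> x) = 0"
  shows "AE x in lebesgue_on \<Omega>. f x = 0"
proof -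
  have \<Omega>s: "\<Omega> \<inter> space lebesgue \<in> sets lebesgue" using \<Omega> by auto
  have fm: "(\<lambda>x. indicator \<Omega> x *\<^sub>R f x) \<in> borel_measurable lebesgue"
    using f unfolding L2_def by (simp add: borel_measurable_restrict_space_iff[OF \<Omega>s])
  have fi: "integrable lebesgue (\<lambda>x. indicator \<Omega> x *\<^sub>R (norm (f x))\<^sup>2)"
    using f unfolding L2_def by (simp add: integrable_restrict_space[OF \<Omega>s])
  \<comment> \<open>The extension of \<open>f\<close> by zero is only Lebesgue measurable; a Borel
    representative makes the lemmas about \<open>lborel\<close> applicable.\<close>
  obtain F where [measurable]: "F \<in> borel_measurable lborel"
    and F_lborel: "AE x in lborel. indicator \<Omega> x *\<^sub>R f x = F x"
    using completion_ex_borel_measurable_real[OF fm] by blast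
  then have F: "AE x in lebesgue. indicator \<Omega> x *\<^sub>R f x = F x"
    using AE_completion by blast
  have Fl [measurable]: "F \<in> borel_measurable lebesgue"
    by (intro measurable_completion) simp
  have "integrable lebesgue (\<lambda>x. (F x)\<^sup>2)"
    by (rule integrable_cong_AE_imp[OF fi]) (use F in \<open>auto simp: indicator_def elim!: eventually_mono split: if_splits\<close>)
  then have F2: "integrable lborel (\<lambda>x. (F x)\<^sup>2)"
    by (subst (asm) integrable_completion) simp_all
  have testF: "(LINT x|lborel. F x * \<phi> x) = 0" if \<phi>: "\<phi> \<in> test_functions \<Omega>" for \<phi>
  proof -
    have [measurable]: "\<phi> \<in> borel_measurable borel"
      using \<phi> by (intro smooth_on_borel_measurable) (simp add: test_functions_def)
    have [measurable]: "\<phi> \<in> borel_measurable lebesgue"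
      by (intro measurable_completion) simp
    have "(LINT x|lborel. F x * \<phi> x) = (LINT x|lebesgue. F x * \<phi> x)"
      by (rule integral_completion[symmetric]) simp
    also have "\<dots> = (LINT x|lebesgue. (indicator \<Omega> x *\<^sub>R f x) * \<phi> x)"
      by (rule integral_cong_AE) (use F fm in \<open>auto elim!: eventually_mono\<close>)
    also have "\<dots> = (LINT x|lebesgue_on \<Omega>. f x * \<phi> x)"
      by (subst integral_restrict_space[OF \<Omega>s]) (simp add: mult.assoc)
    finally show ?thesis using test[OF \<phi>] by simp
  qed
  have F0: "AE x in lebesgue. x \<in> cbox a b \<longrightarrow> F x = 0" if ab: "cbox a b \<subseteq> \<Omega>" for a b
  proof -
    have "integrable lborel (\<lambda>x. indicator (box a b) x * F x)"
    proof (rule Bochner_Integration.integrable_bound)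
      show "integrable lborel (\<lambda>x. indicator (box a b) x + (F x)\<^sup>2)"
        using F2 emeasure_bounded_finite[OF bounded_box]
        by (intro Bochner_Integration.integrable_add integrable_real_indicator) auto
      \<comment> \<open>Square integrability gives integrability on sets of finite measure by this
        bound, and boxes have finite measure.\<close>
      have "\<bar>F x\<bar> \<le> 1 + (F x)\<^sup>2" for x
        using sum_squares_bound[of 1 "\<bar>F x\<bar>"] abs_ge_zero[of "F x"] by simp
      then show "AE x in lborel. norm (indicator (box a b) x * F x)
          \<le> norm (indicator (box a b) x + (F x)\<^sup>2)"
        by (intro AE_I2) (auto simp: indicator_def)
    qed simp
    then have "AE x in lebesgue. indicator (box a b) x * F x = 0"
      by (intro AE_completion AE_eq_0_on_box_of_test_integrals[OF _ ab testF])
    \<comment> \<open>The local result concerns open boxes, the countable cover below uses closed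
      ones; the faces in between are null.\<close>
    moreover have "AE x in lebesgue. x \<notin> cbox a b - box a b"
      by (intro AE_not_in) (simp add: negligible_iff_null_sets[symmetric] negligible_frontier_interval)
    ultimately show ?thesis
      by eventually_elim (auto simp: indicator_def split: if_splits)
  qed
  obtain \<D> where \<D>: "countable \<D>" "\<D> \<subseteq> Pow \<Omega>" "\<And>X. X \<in> \<D> \<Longrightarrow> \<exists>a b. X = cbox a b" "\<Union>\<D> = \<Omega>"
    using open_countable_Union_open_cbox[OF \<Omega>] by blast
  have "AE x in lebesgue. \<forall>X\<in>\<D>. x \<in> X \<longrightarrow> F x = 0"
    unfolding AE_ball_countable[OF \<D>(1)] using \<D>(2,3) F0 by blast
  with F have "AE x in lebesgue. x \<in> \<Omega> \<longrightarrow> f x = 0"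
    by eventually_elim (use \<D>(4) in \<open>auto simp: indicator_def split: if_splits\<close>)
  then show ?thesis
    by (simp add: AE_restrict_space_iff[OF \<Omega>s])
qed

subsection \<open>The space of square-integrable functions\<close>

text \<open>The codomain is an arbitrary Euclidean space, so that functions and gradient fields
  share one set of Hilbert space lemmas.\<close>

definition L2_inner :: "'a::euclidean_space set \<Rightarrow> ('a \<Rightarrow> 'b::euclidean_space) \<Rightarrow> ('a \<Rightarrow> 'b) \<Rightarrow> real" where
  "L2_inner \<Omega> f g = (LINT x|lebesgue_on \<Omega>. f x \<bullet> g x)"

lemma L2_measurable: "f \<in> L2 \<Omega> \<Longrightarrow> f \<in> borel_measurable (lebesgue_on \<Omega>)"
  by (simp add: L2_def)

lemma L2_integrable_inner:
  assumes "f \<in> L2 \<Omega>" "g \<in> L2 \<Omega>"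
  shows "integrable (lebesgue_on \<Omega>) (\<lambda>x. f x \<bullet> g x)"
proof (rule Bochner_Integration.integrable_bound)
  show "integrable (lebesgue_on \<Omega>) (\<lambda>x. (norm (f x))\<^sup>2 + (norm (g x))\<^sup>2)"
    using assms by (auto simp: L2_def)
  show "(\<lambda>x. f x \<bullet> g x) \<in> borel_measurable (lebesgue_on \<Omega>)"
    using assms by (auto simp: L2_def)
  have "\<bar>a \<bullet> b\<bar> \<le> (norm a)\<^sup>2 + (norm b)\<^sup>2" for a b :: 'b
  proof -
    have "\<bar>a \<bullet> b\<bar> \<le> norm a * norm b" by (rule Cauchy_Schwarz_ineq2)
    also have "\<dots> \<le> (norm a)\<^sup>2 + (norm b)\<^sup>2"
      using sum_squares_bound[of "norm a" "norm b"] mult_nonneg_nonneg[OF norm_ge_zero[of a] norm_ge_zero[of b]]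
      by (simp only: mult.assoc)
    finally show ?thesis .
  qed
  then show "AE x in lebesgue_on \<Omega>. norm (f x \<bullet> g x) \<le> norm ((norm (f x))\<^sup>2 + (norm (g x))\<^sup>2)"
    by (intro AE_I2) (simp add: order_trans[OF _ abs_ge_self])
qed

lemma L2_bounded_by:
  assumes "g \<in> L2 \<Omega>" "f \<in> borel_measurable (lebesgue_on \<Omega>)" "\<And>x. x \<in> \<Omega> \<Longrightarrow> norm (f x) \<le> norm (g x)"
  shows "f \<in> L2 \<Omega>"
  using assms unfolding L2_def
  by (auto intro!: Bochner_Integration.integrable_bound[of _ "\<lambda>x. (norm (g x))\<^sup>2"] AE_I2 power_mono)

lemma L2_diff:
  assumes "f \<in> L2 \<Omega>" "g \<in> L2 \<Omega>"
  shows "(\<lambda>x. f x - g x) \<in> L2 \<Omega>"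
proof -
  have "integrable (lebesgue_on \<Omega>) (\<lambda>x. (norm (f x))\<^sup>2 - 2 * (f x \<bullet> g x) + (norm (g x))\<^sup>2)"
    using assms L2_integrable_inner[OF assms] by (auto simp: L2_def)
  moreover have "(norm (a - b))\<^sup>2 = (norm a)\<^sup>2 - 2 * (a \<bullet> b) + (norm b)\<^sup>2" for a b :: 'b
    by (simp add: power2_norm_eq_inner inner_diff inner_commute)
  ultimately show ?thesis
    using assms by (auto simp: L2_def intro!: borel_measurable_diff)
qed

lemma L2_scaleR: "f \<in> L2 \<Omega> \<Longrightarrow> (\<lambda>x. c *\<^sub>R f x) \<in> L2 \<Omega>"
  by (auto simp: L2_def power_mult_distrib intro!: borel_measurable_scaleR)

lemma L2_add:
  assumes "f \<in> L2 \<Omega>" "g \<in> L2 \<Omega>"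
  shows "(\<lambda>x. f x + g x) \<in> L2 \<Omega>"
  using L2_diff[OF assms(1) L2_scaleR[OF assms(2), of "-1"]] by simp

lemma L2_inner_component:
  assumes "G \<in> L2 \<Omega>"
  shows "(\<lambda>x. G x \<bullet> i) \<in> L2 \<Omega>"
  by (rule L2_bounded_by[of "\<lambda>x. norm i *\<^sub>R G x"])
    (use assms L2_measurable[OF assms] in \<open>auto intro: L2_scaleR simp: Cauchy_Schwarz_ineq2 mult.commute[of "norm i"]\<close>)

lemma L2_inner_commute: "L2_inner \<Omega> f g = L2_inner \<Omega> g f"
  by (simp add: L2_inner_def inner_commute)

lemma L2_inner_diff_left:
  assumes "f \<in> L2 \<Omega>" "g \<in> L2 \<Omega>" "h \<in> L2 \<Omega>"
  shows "L2_inner \<Omega> (\<lambda>x. f x - g x) h = L2_inner \<Omega> f h - L2_inner \<Omega> g h"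
  using assms by (simp add: L2_inner_def inner_diff_left L2_integrable_inner)

lemma L2_inner_nonneg: "0 \<le> L2_inner \<Omega> f f"
  by (simp add: L2_inner_def)

lemma L2_inner_cong_AE:
  assumes "f \<in> L2 \<Omega>" "f' \<in> L2 \<Omega>" "g \<in> L2 \<Omega>" "g' \<in> L2 \<Omega>"
    and "AE x in lebesgue_on \<Omega>. f x = f' x" "AE x in lebesgue_on \<Omega>. g x = g' x"
  shows "L2_inner \<Omega> f g = L2_inner \<Omega> f' g'"
  unfolding L2_inner_def
proof (rule integral_cong_AE)
  show "AE x in lebesgue_on \<Omega>. f x \<bullet> g x = f' x \<bullet> g' x"
    using assms(5,6) by eventually_elim simp
qed (use assms(1-4)[THEN L2_measurable] in \<open>auto intro!: borel_measurable_inner\<close>)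

lemma L2_inner_self_eq_0D:
  assumes "f \<in> L2 \<Omega>" "L2_inner \<Omega> f f = 0"
  shows "AE x in lebesgue_on \<Omega>. f x = 0"
  using assms integral_nonneg_eq_0_iff_AE[OF L2_integrable_inner[OF assms(1) assms(1)]]
  by (simp add: L2_inner_def)

lemma L2_Cauchy_Schwarz:
  assumes f: "f \<in> L2 \<Omega>" and g: "g \<in> L2 \<Omega>"
  shows "(L2_inner \<Omega> f g)\<^sup>2 \<le> L2_inner \<Omega> f f * L2_inner \<Omega> g g"
proof (cases "L2_inner \<Omega> g g = 0")
  case True
  have "L2_inner \<Omega> f g = L2_inner \<Omega> f (\<lambda>x. 0)"
    using f g L2_inner_self_eq_0D[OF g True] by (intro L2_inner_cong_AE) (auto simp: L2_def)
  then show ?thesis by (simp add: True L2_inner_def)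
next
  case False
  define B where "B = L2_inner \<Omega> g g"
  \<comment> \<open>The coefficient of the orthogonal projection of \<open>f\<close> onto
    \<open>g\<close>, which minimises the norm of \<open>f - c *\<^sub>R g\<close>.\<close>
  define c where "c = L2_inner \<Omega> f g / B"
  have B: "B > 0" using False L2_inner_nonneg[of \<Omega> g] by (simp add: B_def)
  have cg: "(\<lambda>x. c *\<^sub>R g x) \<in> L2 \<Omega>" by (rule L2_scaleR[OF g])
  have scale: "L2_inner \<Omega> (\<lambda>x. c *\<^sub>R g x) h = c * L2_inner \<Omega> g h" for h
    by (simp add: L2_inner_def)
  have "0 \<le> L2_inner \<Omega> (\<lambda>x. f x - c *\<^sub>R g x) (\<lambda>x. f x - c *\<^sub>R g x)"
    by (rule L2_inner_nonneg)
  also have "\<dots> = L2_inner \<Omega> f f - 2 * c * L2_inner \<Omega> f g + c\<^sup>2 * B"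
  proof -
    let ?d = "\<lambda>x. f x - c *\<^sub>R g x"
    have d: "?d \<in> L2 \<Omega>" by (rule L2_diff[OF f cg])
    have "L2_inner \<Omega> ?d ?d = L2_inner \<Omega> ?d f - c * L2_inner \<Omega> ?d g"
      unfolding L2_inner_diff_left[OF f cg d] scale L2_inner_commute[of _ f ?d]
        L2_inner_commute[of _ g ?d] ..
    moreover have "L2_inner \<Omega> ?d f = L2_inner \<Omega> f f - c * L2_inner \<Omega> f g"
      unfolding L2_inner_diff_left[OF f cg f] scale by (simp add: L2_inner_commute[of _ g f])
    moreover have "L2_inner \<Omega> ?d g = L2_inner \<Omega> f g - c * B"
      unfolding L2_inner_diff_left[OF f cg g] scale B_def ..
    ultimately show ?thesis
      by (simp add: power2_eq_square algebra_simps)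
  qed
  also have "\<dots> = L2_inner \<Omega> f f - (L2_inner \<Omega> f g)\<^sup>2 / B"
    using B by (simp add: c_def power2_eq_square field_simps)
  finally have "(L2_inner \<Omega> f g)\<^sup>2 / B \<le> L2_inner \<Omega> f f" by simp
  then show ?thesis using B by (simp add: B_def pos_divide_le_eq)
qed

lemma L2_inner_tendsto_left:
  assumes \<phi>: "\<And>k. \<phi> k \<in> L2 \<Omega>" and f: "f \<in> L2 \<Omega>" and g: "g \<in> L2 \<Omega>"
    and lim: "(\<lambda>k. L2_inner \<Omega> (\<lambda>x. f x - \<phi> k x) (\<lambda>x. f x - \<phi> k x)) \<longlonglongrightarrow> 0"
  shows "(\<lambda>k. L2_inner \<Omega> (\<phi> k) g) \<longlonglongrightarrow> L2_inner \<Omega> f g"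
proof -
  have "(\<lambda>k. (L2_inner \<Omega> (\<lambda>x. f x - \<phi> k x) g)\<^sup>2) \<longlonglongrightarrow> 0"
  proof (rule tendsto_sandwich[OF _ _ tendsto_const])
    show "\<forall>\<^sub>F k in sequentially. (L2_inner \<Omega> (\<lambda>x. f x - \<phi> k x) g)\<^sup>2
        \<le> L2_inner \<Omega> (\<lambda>x. f x - \<phi> k x) (\<lambda>x. f x - \<phi> k x) * L2_inner \<Omega> g g"
      using L2_Cauchy_Schwarz[OF L2_diff[OF f \<phi>] g] by simp
    show "(\<lambda>k. L2_inner \<Omega> (\<lambda>x. f x - \<phi> k x) (\<lambda>x. f x - \<phi> k x) * L2_inner \<Omega> g g) \<longlonglongrightarrow> 0"
      using tendsto_mult_right[OF lim] by simp
  qed simp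
  then have "(\<lambda>k. L2_inner \<Omega> f g - L2_inner \<Omega> (\<phi> k) g) \<longlonglongrightarrow> 0"
    by (simp add: L2_inner_diff_left f g \<phi>)
  from tendsto_diff[OF tendsto_const[of "L2_inner \<Omega> f g"] this]
  show ?thesis by simp
qed

text \<open>Pointwise this is \<open>\<bar>a - 2 * b\<bar>\<^sup>2 \<ge> 0\<close> for vectors
  \<open>a\<close>, \<open>b\<close>. It stands in for the triangle inequality without introducing
  square roots, at the price of factors 2.\<close>

lemma L2_inner_self_le:
  assumes f: "f \<in> L2 \<Omega>" and g: "g \<in> L2 \<Omega>"
  shows "L2_inner \<Omega> f f \<le> 2 * L2_inner \<Omega> (\<lambda>x. f x - g x) (\<lambda>x. f x - g x) + 2 * L2_inner \<Omega> g g"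
proof -
  have "a \<bullet> a \<le> 2 * ((a - b) \<bullet> (a - b)) + 2 * (b \<bullet> b)" for a b :: 'b
    using inner_ge_zero[of "a - 2 *\<^sub>R b"] by (simp add: inner_diff inner_commute)
  then have "L2_inner \<Omega> f f \<le> (LINT x|lebesgue_on \<Omega>.
      2 * ((f x - g x) \<bullet> (f x - g x)) + 2 * (g x \<bullet> g x))"
    unfolding L2_inner_def
    by (intro integral_mono Bochner_Integration.integrable_add integrable_mult_right L2_integrable_inner L2_diff f g)
  also have "\<dots> = 2 * L2_inner \<Omega> (\<lambda>x. f x - g x) (\<lambda>x. f x - g x) + 2 * L2_inner \<Omega> g g"
    unfolding L2_inner_def
    by (subst Bochner_Integration.integral_add)
      (auto intro!: integrable_mult_right L2_integrable_inner L2_diff f g)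
  finally show ?thesis .
qed

lemma L2_inner_diff_self_le:
  assumes f: "f \<in> L2 \<Omega>" and g: "g \<in> L2 \<Omega>"
  shows "L2_inner \<Omega> (\<lambda>x. f x - g x) (\<lambda>x. f x - g x) \<le> 2 * L2_inner \<Omega> f f + 2 * L2_inner \<Omega> g g"
  using L2_inner_self_le[OF L2_diff[OF f g] L2_scaleR[OF g, of "-1"]] by (simp add: L2_inner_def)

subsection \<open>Weak gradients\<close>

lemma continuous_imp_L2:
  fixes f :: "'a::euclidean_space \<Rightarrow> 'b::euclidean_space"
  assumes \<Omega>: "open \<Omega>" "bounded \<Omega>" and f: "continuous_on UNIV f"
  shows "f \<in> L2 \<Omega>"
proof -
  have "\<Omega> \<in> lmeasurable"
    using \<Omega> by (simp add: lmeasurable_open)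
  then interpret finite_measure "lebesgue_on \<Omega>"
    by (rule finite_measure_lebesgue_on)
  have "compact (f ` closure \<Omega>)"
    using \<Omega> f by (intro compact_continuous_image) (auto intro: continuous_on_subset simp: compact_closure)
  then obtain B where B: "\<And>x. x \<in> closure \<Omega> \<Longrightarrow> norm (f x) \<le> B"
    using compact_imp_bounded by (fastforce simp: bounded_iff)
  have m: "f \<in> borel_measurable (lebesgue_on \<Omega>)"
    using \<Omega> f by (intro continuous_imp_measurable_on_sets_lebesgue) (auto intro: continuous_on_subset)
  have "AE x in lebesgue_on \<Omega>. norm ((norm (f x))\<^sup>2) \<le> B\<^sup>2"
    using B closure_subset[of \<Omega>] by (intro AE_I2) (auto intro!: power_mono)
  then have "integrable (lebesgue_on \<Omega>) (\<lambda>x. (norm (f x))\<^sup>2)"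
    using m by (intro integrable_const_bound) auto
  with m show ?thesis by (simp add: L2_def)
qed

text \<open>The classical gradient as a vector field, so that it can be compared with
  \<open>weak_grad\<close>; the weak formulations themselves use only
  \<open>frechet_derivative\<close>.\<close>

definition grad :: "('a::euclidean_space \<Rightarrow> real) \<Rightarrow> 'a \<Rightarrow> 'a" where
  "grad \<phi> x = (\<Sum>i\<in>Basis. frechet_derivative \<phi> (at x) i *\<^sub>R i)"

lemma grad_inner:
  assumes "\<phi> differentiable (at x)"
  shows "grad \<phi> x \<bullet> h = frechet_derivative \<phi> (at x) h"
proof -
  interpret linear "frechet_derivative \<phi> (at x)"
    by (rule linear_frechet_derivative[OF assms])
  have "frechet_derivative \<phi> (at x) h = frechet_derivative \<phi> (at x) (\<Sum>i\<in>Basis. (h \<bullet> i) *\<^sub>R i)"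
    by (simp add: euclidean_representation)
  also have "\<dots> = (\<Sum>i\<in>Basis. (h \<bullet> i) * frechet_derivative \<phi> (at x) i)"
    by (simp add: sum scaleR)
  finally show ?thesis
    by (simp add: grad_def inner_sum_left inner_commute[of h] mult.commute)
qed

lemma test_function_smooth: "\<phi> \<in> test_functions \<Omega> \<Longrightarrow> smooth_on UNIV \<phi>"
  by (simp add: test_functions_def)

lemma smooth_imp_L2:
  fixes \<Omega> :: "'a::euclidean_space set"
  assumes "open \<Omega>" "bounded \<Omega>" "smooth_on UNIV \<phi>"
  shows "\<phi> \<in> L2 \<Omega>" "grad \<phi> \<in> L2 \<Omega>" "(\<lambda>x. frechet_derivative \<phi> (at x) h) \<in> L2 \<Omega>"
proof -
  have c: "continuous_on UNIV (\<lambda>x. frechet_derivative \<phi> (at x) h)" for h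
    by (intro smooth_on_continuous smooth_on_frechet_derivative assms)
  show "grad \<phi> \<in> L2 \<Omega>"
    unfolding grad_def by (intro continuous_imp_L2 assms continuous_intros c)
  show "(\<lambda>x. frechet_derivative \<phi> (at x) h) \<in> L2 \<Omega>"
    by (intro continuous_imp_L2 assms c)
  show "\<phi> \<in> L2 \<Omega>"
    by (intro continuous_imp_L2 assms smooth_on_continuous)
qed

lemma test_function_diff:
  assumes "\<phi> \<in> test_functions \<Omega>" "\<psi> \<in> test_functions \<Omega>"
  shows "(\<lambda>x. \<phi> x - \<psi> x) \<in> test_functions \<Omega>"
proof -
  obtain K L where K: "compact K" "K \<subseteq> \<Omega>" "\<forall>x. x \<notin> K \<longrightarrow> \<phi> x = 0"
    and L: "compact L" "L \<subseteq> \<Omega>" "\<forall>x. x \<notin> L \<longrightarrow> \<psi> x = 0"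
    using assms by (auto simp: test_functions_def)
  then have "compact (K \<union> L)" "K \<union> L \<subseteq> \<Omega>" "\<forall>x. x \<notin> K \<union> L \<longrightarrow> \<phi> x - \<psi> x = 0"
    by auto
  then show ?thesis
    using smooth_on_diff[OF assms[THEN test_function_smooth]] unfolding test_functions_def by blast
qed

text \<open>The product \<open>f * \<psi>\<close> has compact support, so the integral of its
  partial derivative is zero, whatever \<open>f\<close> does near the boundary. It serves both for
  weak gradients of smooth functions and, with \<open>f x = (x \<bullet> i) * \<phi> x\<close>, for
  Poincare's inequality.\<close>

lemma integral_frechet_derivative_mult_test_function:
  fixes f :: "'a::euclidean_space \<Rightarrow> real"
  assumes \<Omega>: "open \<Omega>" "bounded \<Omega>" and f: "smooth_on UNIV f" and \<psi>: "\<psi> \<in> test_functions \<Omega>"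
    and i: "i \<in> Basis"
  shows "(LINT x|lebesgue_on \<Omega>. f x * frechet_derivative \<psi> (at x) i)
    = - (LINT x|lebesgue_on \<Omega>. frechet_derivative f (at x) i * \<psi> x)"
proof -
  obtain K where K: "compact K" "K \<subseteq> \<Omega>" "\<And>x. x \<notin> K \<Longrightarrow> \<psi> x = 0"
    using \<psi> by (auto simp: test_functions_def)
  have \<psi>s: "smooth_on UNIV \<psi>" by (rule test_function_smooth[OF \<psi>])
  note diff = smooth_on_differentiable[OF f] smooth_on_differentiable[OF \<psi>s]
  define h where "h x = f x * \<psi> x" for x
  have hs: "smooth_on UNIV h"
    unfolding h_def by (intro smooth_on_mult f \<psi>s)
  have hi: "frechet_derivative h (at x) i =
      f x * frechet_derivative \<psi> (at x) i + frechet_derivative f (at x) i * \<psi> x" for x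
    unfolding h_def by (rule frechet_derivative_mult'[OF diff])
  \<comment> \<open>Outside \<open>\<Omega>\<close> the product is zero on the open set
    \<open>- K\<close>, so integrals over \<open>\<Omega>\<close> and over the whole space
    agree.\<close>
  have out: "frechet_derivative h (at x) i = 0" if x: "x \<notin> \<Omega>" for x
  proof -
    have "frechet_derivative (\<lambda>_. 0) (at x) = frechet_derivative h (at x)"
      by (rule frechet_derivative_transform_within_open[of _ _ "- K"])
        (use K x in \<open>auto simp: h_def compact_imp_closed\<close>)
    then show ?thesis by (metis frechet_derivative_const)
  qed
  have \<Omega>s: "\<Omega> \<inter> space lebesgue \<in> sets lebesgue" using \<Omega> by auto
  have meas: "(\<lambda>x. frechet_derivative h (at x) i) \<in> borel_measurable lborel"
    using smooth_on_borel_measurable[OF smooth_on_frechet_derivative[OF hs]] by simp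
  have "(LINT x|lebesgue_on \<Omega>. frechet_derivative h (at x) i) = (LINT x|lebesgue. frechet_derivative h (at x) i)"
    unfolding integral_restrict_space[OF \<Omega>s]
    by (rule Bochner_Integration.integral_cong) (auto simp: indicator_def out)
  also have "\<dots> = (LINT x|lborel. frechet_derivative h (at x) i)"
    by (rule integral_completion[OF meas])
  also have "\<dots> = 0"
  proof (rule integral_partial_derivative_eq_0[OF _ _ i K(1)])
    show "(h has_derivative frechet_derivative h (at x)) (at x)" for x
      using smooth_on_differentiable[OF hs] by (simp add: frechet_derivative_works)
    show "continuous_on UNIV (\<lambda>x. frechet_derivative h (at x) i)"
      by (intro smooth_on_continuous smooth_on_frechet_derivative hs)
  qed (simp add: h_def K)
  finally have "(LINT x|lebesgue_on \<Omega>. f x * frechet_derivative \<psi> (at x) i + frechet_derivative f (at x) i * \<psi> x) = 0"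
    by (simp add: hi)
  moreover have "integrable (lebesgue_on \<Omega>) (\<lambda>x. f x * frechet_derivative \<psi> (at x) i)"
    using L2_integrable_inner[OF smooth_imp_L2(1)[OF \<Omega> f] smooth_imp_L2(3)[OF \<Omega> \<psi>s, of i]] by simp
  moreover have "integrable (lebesgue_on \<Omega>) (\<lambda>x. frechet_derivative f (at x) i * \<psi> x)"
    using L2_integrable_inner[OF smooth_imp_L2(3)[OF \<Omega> f, of i] smooth_imp_L2(1)[OF \<Omega> \<psi>s]] by simp
  ultimately show ?thesis by simp
qed

lemma has_weak_gradient_smooth:
  assumes "open \<Omega>" "bounded \<Omega>" "smooth_on UNIV f"
  shows "has_weak_gradient \<Omega> f (grad f)"
  unfolding has_weak_gradient_def
  using integral_frechet_derivative_mult_test_function[OF assms]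
  by (simp add: grad_inner smooth_on_differentiable[OF assms(3)])

lemma has_weak_gradient_diff:
  assumes \<Omega>: "open \<Omega>" "bounded \<Omega>"
    and u: "u \<in> L2 \<Omega>" "G \<in> L2 \<Omega>" "has_weak_gradient \<Omega> u G"
    and v: "v \<in> L2 \<Omega>" "H \<in> L2 \<Omega>" "has_weak_gradient \<Omega> v H"
  shows "has_weak_gradient \<Omega> (\<lambda>x. u x - v x) (\<lambda>x. G x - H x)"
  unfolding has_weak_gradient_def
proof (intro ballI)
  fix \<phi> and i :: 'a assume \<phi>: "\<phi> \<in> test_functions \<Omega>" and i: "i \<in> Basis"
  note s = smooth_imp_L2[OF \<Omega> test_function_smooth[OF \<phi>]]
  have "L2_inner \<Omega> (\<lambda>x. u x - v x) (\<lambda>x. frechet_derivative \<phi> (at x) i)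
      = - L2_inner \<Omega> (\<lambda>x. G x \<bullet> i - H x \<bullet> i) \<phi>"
    using u(3) v(3) \<phi> i unfolding has_weak_gradient_def
    by (simp add: L2_inner_diff_left L2_inner_component u v s) (simp add: L2_inner_def)
  then show "(LINT x|lebesgue_on \<Omega>. (u x - v x) * frechet_derivative \<phi> (at x) i)
      = - (LINT x|lebesgue_on \<Omega>. ((G x - H x) \<bullet> i) * \<phi> x)"
    by (simp add: L2_inner_def inner_diff_left)
qed

text \<open>The fundamental lemma applied to each component of the difference. As
  \<open>weak_grad\<close> is made by choice, this is the only access to its value: one exhibits
  some weak gradient and concludes equality almost everywhere.\<close>

lemma weak_gradient_unique:
  assumes \<Omega>: "open \<Omega>" "bounded \<Omega>"
    and G: "G \<in> L2 \<Omega>" "has_weak_gradient \<Omega> u G" and H: "H \<in> L2 \<Omega>" "has_weak_gradient \<Omega> u H"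
  shows "AE x in lebesgue_on \<Omega>. G x = H x"
proof -
  have "AE x in lebesgue_on \<Omega>. (G x - H x) \<bullet> i = 0" if i: "i \<in> Basis" for i
  proof (rule AE_eq_0_of_test_integrals[OF \<Omega>(1)])
    show "(\<lambda>x. (G x - H x) \<bullet> i) \<in> L2 \<Omega>"
      by (intro L2_inner_component L2_diff G H)
    fix \<phi> assume \<phi>: "\<phi> \<in> test_functions \<Omega>"
    have "L2_inner \<Omega> (\<lambda>x. G x \<bullet> i - H x \<bullet> i) \<phi> = 0"
      using G(2) H(2) \<phi> i unfolding has_weak_gradient_def
      by (simp add: L2_inner_diff_left L2_inner_component G H
          smooth_imp_L2[OF \<Omega> test_function_smooth[OF \<phi>]]) (simp add: L2_inner_def)
    then show "(LINT x|lebesgue_on \<Omega>. ((G x - H x) \<bullet> i) * \<phi> x) = 0"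
      by (simp add: L2_inner_def inner_diff_left)
  qed
  then have "AE x in lebesgue_on \<Omega>. \<forall>i\<in>Basis. (G x - H x) \<bullet> i = 0"
    by (intro AE_finite_allI) auto
  then show ?thesis
    by eventually_elim (simp add: euclidean_eq_iff[where 'a = 'a] inner_diff_left)
qed

lemma W12_weak_grad:
  assumes "u \<in> W12 \<Omega>"
  shows "u \<in> L2 \<Omega>" "weak_grad \<Omega> u \<in> L2 \<Omega>" "has_weak_gradient \<Omega> u (weak_grad \<Omega> u)"
proof -
  have "\<exists>G. G \<in> L2 \<Omega> \<and> has_weak_gradient \<Omega> u G" using assms by (auto simp: W12_def)
  then have "weak_grad \<Omega> u \<in> L2 \<Omega> \<and> has_weak_gradient \<Omega> u (weak_grad \<Omega> u)"
    unfolding weak_grad_def by (rule someI_ex)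
  then show "weak_grad \<Omega> u \<in> L2 \<Omega>" "has_weak_gradient \<Omega> u (weak_grad \<Omega> u)" by auto
  show "u \<in> L2 \<Omega>" using assms by (simp add: W12_def)
qed

lemma W12_diff:
  assumes \<Omega>: "open \<Omega>" "bounded \<Omega>" and uv: "u \<in> W12 \<Omega>" "v \<in> W12 \<Omega>"
  shows "(\<lambda>x. u x - v x) \<in> W12 \<Omega>"
    and "AE x in lebesgue_on \<Omega>. weak_grad \<Omega> (\<lambda>x. u x - v x) x = weak_grad \<Omega> u x - weak_grad \<Omega> v x"
proof -
  note uw = W12_weak_grad[OF uv(1)] and vw = W12_weak_grad[OF uv(2)]
  show W: "(\<lambda>x. u x - v x) \<in> W12 \<Omega>"
    using L2_diff[OF uw(1) vw(1)] L2_diff[OF uw(2) vw(2)] has_weak_gradient_diff[OF \<Omega> uw vw]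
    by (auto simp: W12_def)
  show "AE x in lebesgue_on \<Omega>. weak_grad \<Omega> (\<lambda>x. u x - v x) x = weak_grad \<Omega> u x - weak_grad \<Omega> v x"
    by (rule weak_gradient_unique[OF \<Omega> W12_weak_grad(2,3)[OF W] L2_diff[OF uw(2) vw(2)] has_weak_gradient_diff[OF \<Omega> uw vw]])
qed

lemma W12_test_function:
  assumes \<Omega>: "open \<Omega>" "bounded \<Omega>" and \<phi>: "\<phi> \<in> test_functions \<Omega>"
  shows "\<phi> \<in> W12 \<Omega>" "AE x in lebesgue_on \<Omega>. weak_grad \<Omega> \<phi> x = grad \<phi> x"
proof -
  note s = smooth_imp_L2[OF \<Omega> test_function_smooth[OF \<phi>]]
  note g = has_weak_gradient_smooth[OF \<Omega> test_function_smooth[OF \<phi>]]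
  show W: "\<phi> \<in> W12 \<Omega>" using s g by (auto simp: W12_def)
  show "AE x in lebesgue_on \<Omega>. weak_grad \<Omega> \<phi> x = grad \<phi> x"
    by (rule weak_gradient_unique[OF \<Omega> W12_weak_grad(2,3)[OF W] s(2) g])
qed

section \<open>The Dirichlet energy and the space \<open>W12_0\<close>\<close>

definition dirichlet :: "'a::euclidean_space set \<Rightarrow> ('a \<Rightarrow> real) \<Rightarrow> real" where
  "dirichlet \<Omega> u = L2_inner \<Omega> (weak_grad \<Omega> u) (weak_grad \<Omega> u)"

lemma W12_norm_eq: "W12_norm \<Omega> u = sqrt (L2_inner \<Omega> u u + dirichlet \<Omega> u)"
  by (simp add: W12_norm_def L2_inner_def dirichlet_def power2_norm_eq_inner) (simp add: power2_eq_square)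

lemma dirichlet_nonneg: "0 \<le> dirichlet \<Omega> u"
  by (simp add: dirichlet_def L2_inner_nonneg)

lemma dirichlet_diff:
  assumes \<Omega>: "open \<Omega>" "bounded \<Omega>" and uv: "u \<in> W12 \<Omega>" "v \<in> W12 \<Omega>"
  shows "dirichlet \<Omega> (\<lambda>x. u x - v x) = L2_inner \<Omega>
    (\<lambda>x. weak_grad \<Omega> u x - weak_grad \<Omega> v x) (\<lambda>x. weak_grad \<Omega> u x - weak_grad \<Omega> v x)"
  unfolding dirichlet_def
  by (intro L2_inner_cong_AE L2_diff W12_weak_grad W12_diff[OF \<Omega>] uv)

text \<open>Both summands under the root are nonnegative, so each is squeezed by their sum. Later
  limits can then be taken for the quadratic quantities separately.\<close>

lemma W12_norm_tendsto_0_iff: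
  "(\<lambda>k. W12_norm \<Omega> (u k)) \<longlonglongrightarrow> 0 \<longleftrightarrow>
     (\<lambda>k. L2_inner \<Omega> (u k) (u k)) \<longlonglongrightarrow> 0 \<and> (\<lambda>k. dirichlet \<Omega> (u k)) \<longlonglongrightarrow> 0"
proof
  assume "(\<lambda>k. W12_norm \<Omega> (u k)) \<longlonglongrightarrow> 0"
  then have "(\<lambda>k. (W12_norm \<Omega> (u k))\<^sup>2) \<longlonglongrightarrow> 0\<^sup>2" by (rule tendsto_power)
  then have *: "(\<lambda>k. L2_inner \<Omega> (u k) (u k) + dirichlet \<Omega> (u k)) \<longlonglongrightarrow> 0"
    by (simp add: W12_norm_eq L2_inner_nonneg dirichlet_nonneg)
  have "(\<lambda>k. L2_inner \<Omega> (u k) (u k)) \<longlonglongrightarrow> 0"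
    by (rule tendsto_sandwich[OF _ _ tendsto_const *]) (simp_all add: L2_inner_nonneg dirichlet_nonneg)
  moreover have "(\<lambda>k. dirichlet \<Omega> (u k)) \<longlonglongrightarrow> 0"
    by (rule tendsto_sandwich[OF _ _ tendsto_const *]) (simp_all add: L2_inner_nonneg dirichlet_nonneg)
  ultimately show "(\<lambda>k. L2_inner \<Omega> (u k) (u k)) \<longlonglongrightarrow> 0 \<and> (\<lambda>k. dirichlet \<Omega> (u k)) \<longlonglongrightarrow> 0" ..
next
  assume "(\<lambda>k. L2_inner \<Omega> (u k) (u k)) \<longlonglongrightarrow> 0 \<and> (\<lambda>k. dirichlet \<Omega> (u k)) \<longlonglongrightarrow> 0"
  then have "(\<lambda>k. sqrt (L2_inner \<Omega> (u k) (u k) + dirichlet \<Omega> (u k))) \<longlonglongrightarrow> sqrt (0 + 0)"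
    by (intro tendsto_real_sqrt tendsto_add) auto
  then show "(\<lambda>k. W12_norm \<Omega> (u k)) \<longlonglongrightarrow> 0"
    by (simp add: W12_norm_eq)
qed

lemma W12_0_approx:
  assumes \<Omega>: "open \<Omega>" "bounded \<Omega>" and u: "u \<in> W12_0 \<Omega>"
  obtains \<phi> where "\<And>k. \<phi> k \<in> test_functions \<Omega>"
    and "(\<lambda>k. L2_inner \<Omega> (\<lambda>x. u x - \<phi> k x) (\<lambda>x. u x - \<phi> k x)) \<longlonglongrightarrow> 0"
    and "(\<lambda>k. L2_inner \<Omega> (\<lambda>x. weak_grad \<Omega> u x - grad (\<phi> k) x)
           (\<lambda>x. weak_grad \<Omega> u x - grad (\<phi> k) x)) \<longlonglongrightarrow> 0"
proof -
  obtain \<phi> where \<phi>: "\<And>k. \<phi> k \<in> test_functions \<Omega>"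
    and lim: "(\<lambda>k. W12_norm \<Omega> (\<lambda>x. u x - \<phi> k x)) \<longlonglongrightarrow> 0" and W: "u \<in> W12 \<Omega>"
    using u by (auto simp: W12_0_def)
  have "dirichlet \<Omega> (\<lambda>x. u x - \<phi> k x) = L2_inner \<Omega>
      (\<lambda>x. weak_grad \<Omega> u x - grad (\<phi> k) x) (\<lambda>x. weak_grad \<Omega> u x - grad (\<phi> k) x)" for k
    unfolding dirichlet_diff[OF \<Omega> W W12_test_function(1)[OF \<Omega> \<phi>]]
    using W12_test_function[OF \<Omega> \<phi>, of k]
    by (intro L2_inner_cong_AE L2_diff W12_weak_grad W smooth_imp_L2[OF \<Omega> test_function_smooth[OF \<phi>]])
      (auto elim!: eventually_mono)
  with \<phi> lim show ?thesis
    by (intro that[of \<phi>]) (simp_all add: W12_norm_tendsto_0_iff)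
qed

text \<open>Differences of the approximating test functions approximate the difference: the function
  part and the energy part of the error are each at most twice the sum of the two given
  errors.\<close>

lemma W12_0_diff:
  assumes \<Omega>: "open \<Omega>" "bounded \<Omega>" and uv: "u \<in> W12_0 \<Omega>" "v \<in> W12_0 \<Omega>"
  shows "(\<lambda>x. u x - v x) \<in> W12_0 \<Omega>"
proof -
  have W: "u \<in> W12 \<Omega>" "v \<in> W12 \<Omega>" using uv by (auto simp: W12_0_def)
  obtain \<phi> \<psi> where \<phi>: "\<And>k. \<phi> k \<in> test_functions \<Omega>" "(\<lambda>k. W12_norm \<Omega> (\<lambda>x. u x - \<phi> k x)) \<longlonglongrightarrow> 0"
    and \<psi>: "\<And>k. \<psi> k \<in> test_functions \<Omega>" "(\<lambda>k. W12_norm \<Omega> (\<lambda>x. v x - \<psi> k x)) \<longlonglongrightarrow> 0"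
    using uv by (auto simp: W12_0_def)
  let ?a = "\<lambda>k x. u x - \<phi> k x" and ?b = "\<lambda>k x. v x - \<psi> k x"
  have a: "?a k \<in> W12 \<Omega>" for k by (rule W12_diff[OF \<Omega> W(1) W12_test_function(1)[OF \<Omega> \<phi>(1)]])
  have b: "?b k \<in> W12 \<Omega>" for k by (rule W12_diff[OF \<Omega> W(2) W12_test_function(1)[OF \<Omega> \<psi>(1)]])
  have lim: "(\<lambda>k. 2 * L2_inner \<Omega> (?a k) (?a k) + 2 * L2_inner \<Omega> (?b k) (?b k)) \<longlonglongrightarrow> 2 * 0 + 2 * 0"
    "(\<lambda>k. 2 * dirichlet \<Omega> (?a k) + 2 * dirichlet \<Omega> (?b k)) \<longlonglongrightarrow> 2 * 0 + 2 * 0"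
    using \<phi>(2) \<psi>(2) by (auto simp only: W12_norm_tendsto_0_iff intro!: tendsto_intros)
  have "(\<lambda>k. W12_norm \<Omega> (\<lambda>x. ?a k x - ?b k x)) \<longlonglongrightarrow> 0"
    unfolding W12_norm_tendsto_0_iff
  proof
    show "(\<lambda>k. L2_inner \<Omega> (\<lambda>x. ?a k x - ?b k x) (\<lambda>x. ?a k x - ?b k x)) \<longlonglongrightarrow> 0"
      by (rule tendsto_sandwich[OF _ _ tendsto_const lim(1)[simplified]])
        (auto intro!: always_eventually L2_inner_nonneg L2_inner_diff_self_le W12_weak_grad a b)
    show "(\<lambda>k. dirichlet \<Omega> (\<lambda>x. ?a k x - ?b k x)) \<longlonglongrightarrow> 0"
    proof (rule tendsto_sandwich[OF _ _ tendsto_const lim(2)[simplified]])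
      have "dirichlet \<Omega> (\<lambda>x. ?a k x - ?b k x) \<le> 2 * dirichlet \<Omega> (?a k) + 2 * dirichlet \<Omega> (?b k)" for k
        unfolding dirichlet_diff[OF \<Omega> a b] unfolding dirichlet_def
        by (intro L2_inner_diff_self_le W12_weak_grad a b)
      then show "\<forall>\<^sub>F k in sequentially. dirichlet \<Omega> (\<lambda>x. ?a k x - ?b k x)
          \<le> 2 * dirichlet \<Omega> (?a k) + 2 * dirichlet \<Omega> (?b k)" by simp
    qed (simp add: dirichlet_nonneg)
  qed
  then have "(\<lambda>k. W12_norm \<Omega> (\<lambda>x. (u x - v x) - (\<phi> k x - \<psi> k x))) \<longlonglongrightarrow> 0"
    by (simp add: algebra_simps)
  then show ?thesis
    using W12_diff(1)[OF \<Omega> W] test_function_diff[OF \<phi>(1) \<psi>(1)]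
    unfolding W12_0_def by (auto intro!: exI[of _ "\<lambda>k x. \<phi> k x - \<psi> k x"])
qed

lemma test_function_W12_0:
  assumes \<Omega>: "open \<Omega>" "bounded \<Omega>" and \<phi>: "\<phi> \<in> test_functions \<Omega>"
  shows "\<phi> \<in> W12_0 \<Omega>"
proof -
  note W = W12_test_function(1)[OF \<Omega> \<phi>]
  \<comment> \<open>The weak gradient chosen for the zero function need not vanish pointwise;
    \<open>dirichlet_diff\<close> replaces it by a difference that does.\<close>
  have "dirichlet \<Omega> (\<lambda>x. \<phi> x - \<phi> x) = 0"
    unfolding dirichlet_diff[OF \<Omega> W W] by (simp add: L2_inner_def)
  then have "W12_norm \<Omega> (\<lambda>x. \<phi> x - \<phi> x) = 0"
    by (simp add: W12_norm_eq) (simp add: L2_inner_def)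
  then show ?thesis
    unfolding W12_0_def using W \<phi> by (auto intro!: exI[of _ "\<lambda>_. \<phi>"])
qed

subsection \<open>Poincare's inequality and the first eigenvalue\<close>

lemma smooth_on_inner: "smooth_on UNIV (\<lambda>x. x \<bullet> i)"
proof -
  have der: "((\<lambda>x. x \<bullet> i) has_derivative (\<lambda>h. h \<bullet> i)) (at x)" for x
    by (auto intro!: derivative_eq_intros)
  have fd: "frechet_derivative (\<lambda>x. x \<bullet> i) (at x) = (\<lambda>h. h \<bullet> i)" for x
    using frechet_derivative_at[OF der] by simp
  have diff: "(\<lambda>x. x \<bullet> i) differentiable (at x)" for x
    unfolding differentiable_def using der by blast
  have "Ck_on k UNIV (\<lambda>x. x \<bullet> i)" for k
    by (cases k) (auto simp: fd diff Ck_on_const intro: continuous_intros)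
  then show ?thesis by (simp add: smooth_on_def)
qed

lemma Poincare_test_function:
  fixes \<Omega> :: "'a::euclidean_space set"
  assumes \<Omega>: "open \<Omega>" "bounded \<Omega>" and R: "\<And>x. x \<in> \<Omega> \<Longrightarrow> norm x \<le> R"
    and \<phi>: "\<phi> \<in> test_functions \<Omega>"
  shows "L2_inner \<Omega> \<phi> \<phi> \<le> 4 * R\<^sup>2 * L2_inner \<Omega> (grad \<phi>) (grad \<phi>)"
proof -
  obtain i :: 'a where i: "i \<in> Basis" using nonempty_Basis by blast
  have \<phi>s: "smooth_on UNIV \<phi>" by (rule test_function_smooth[OF \<phi>])
  note diff = smooth_on_differentiable[OF \<phi>s] and s = smooth_imp_L2[OF \<Omega> \<phi>s]
  define f where "f x = (x \<bullet> i) * \<phi> x" for x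
  let ?d = "\<lambda>x. frechet_derivative \<phi> (at x) i"
  have fs: "smooth_on UNIV f"
    unfolding f_def by (intro smooth_on_mult smooth_on_inner \<phi>s)
  have fd: "frechet_derivative f (at x) i = (x \<bullet> i) * ?d x + \<phi> x" for x
  proof -
    have "(f has_derivative (\<lambda>h. (x \<bullet> i) * frechet_derivative \<phi> (at x) h + (h \<bullet> i) * \<phi> x)) (at x)"
      unfolding f_def using diff[of x] by (intro has_derivative_mult)
        (auto simp: frechet_derivative_works[symmetric] intro!: derivative_eq_intros)
    from fun_cong[OF frechet_derivative_at[OF this], of i] show ?thesis
      using i by (simp add: inner_same_Basis)
  qed
  have int: "integrable (lebesgue_on \<Omega>) (\<lambda>x. f x * ?d x)" "integrable (lebesgue_on \<Omega>) (\<lambda>x. \<phi> x * \<phi> x)"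
    "integrable (lebesgue_on \<Omega>) (\<lambda>x. grad \<phi> x \<bullet> grad \<phi> x)"
    using L2_integrable_inner[OF smooth_imp_L2(1)[OF \<Omega> fs] s(3)[of i]] L2_integrable_inner[OF s(1) s(1)]
      L2_integrable_inner[OF s(2) s(2)] by auto
  \<comment> \<open>Integration by parts of \<open>f\<close> against \<open>\<phi>\<close>. The
    first term of \<open>\<partial>\<^sub>i f * \<phi>\<close> reproduces the left side, the second
    is \<open>\<phi>\<^sup>2\<close>.\<close>
  have "(LINT x|lebesgue_on \<Omega>. f x * ?d x) = - (LINT x|lebesgue_on \<Omega>. f x * ?d x + \<phi> x * \<phi> x)"
    using integral_frechet_derivative_mult_test_function[OF \<Omega> fs \<phi> i]
    by (simp add: fd algebra_simps) (simp add: f_def algebra_simps)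
  then have "L2_inner \<Omega> \<phi> \<phi> = (LINT x|lebesgue_on \<Omega>. - 2 * (f x * ?d x))"
    using int by (simp add: L2_inner_def)
  also have "\<dots> \<le> (LINT x|lebesgue_on \<Omega>. 1/2 * (\<phi> x * \<phi> x) + 2 * R\<^sup>2 * (grad \<phi> x \<bullet> grad \<phi> x))"
  proof (rule integral_mono)
    show "integrable (lebesgue_on \<Omega>) (\<lambda>x. - 2 * (f x * ?d x))"
      by (intro integrable_mult_right int)
    show "integrable (lebesgue_on \<Omega>) (\<lambda>x. 1/2 * (\<phi> x * \<phi> x) + 2 * R\<^sup>2 * (grad \<phi> x \<bullet> grad \<phi> x))"
      by (intro Bochner_Integration.integrable_add integrable_mult_right int)
    fix x assume "x \<in> space (lebesgue_on \<Omega>)"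
    then have x: "norm x \<le> R" using R by simp
    have "\<bar>x \<bullet> i\<bar> \<le> R"
      using Basis_le_norm[OF i, of x] x by linarith
    then have xi: "(x \<bullet> i)\<^sup>2 \<le> R\<^sup>2"
      using abs_le_square_iff[of "x \<bullet> i" R] by linarith
    have "\<bar>?d x\<bar> \<le> norm (grad \<phi> x)"
      using Basis_le_norm[OF i, of "grad \<phi> x"] by (simp add: grad_inner[OF diff])
    then have "(?d x)\<^sup>2 \<le> grad \<phi> x \<bullet> grad \<phi> x"
      using abs_le_square_iff[of "?d x" "norm (grad \<phi> x)"] by (simp add: power2_norm_eq_inner)
    then have "(x \<bullet> i)\<^sup>2 * (?d x)\<^sup>2 \<le> R\<^sup>2 * (grad \<phi> x \<bullet> grad \<phi> x)"
      using xi by (intro mult_mono) auto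
    \<comment> \<open>Young's inequality with the weight that leaves
      \<open>\<phi>\<^sup>2 / 2\<close> on the right. Absorbing this half turns the coefficient
      \<open>2 * R\<^sup>2\<close> into the final \<open>4 * R\<^sup>2\<close>.\<close>
    moreover have "0 \<le> (1/2) * (\<phi> x + 2 * ((x \<bullet> i) * ?d x))\<^sup>2" by simp
    ultimately show "- 2 * (f x * ?d x) \<le> 1/2 * (\<phi> x * \<phi> x) + 2 * R\<^sup>2 * (grad \<phi> x \<bullet> grad \<phi> x)"
      by (simp add: f_def power2_eq_square algebra_simps)
  qed
  also have "\<dots> = 1/2 * L2_inner \<Omega> \<phi> \<phi> + 2 * R\<^sup>2 * L2_inner \<Omega> (grad \<phi>) (grad \<phi>)"
    using int by (simp add: L2_inner_def)
  finally show ?thesis by simp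
qed

text \<open>Passage to the limit along approximating test functions. The extra factor 4 comes from
  using \<open>L2_inner_self_le\<close> twice, once for \<open>u\<close> and once for the gradient;
  any finite constant suffices for the later estimates.\<close>

lemma Poincare_W12_0:
  fixes \<Omega> :: "'a::euclidean_space set"
  assumes \<Omega>: "open \<Omega>" "bounded \<Omega>"
  obtains K where "K > 0" "\<And>u. u \<in> W12_0 \<Omega> \<Longrightarrow> L2_inner \<Omega> u u \<le> K * dirichlet \<Omega> u"
proof -
  obtain R where R: "R > 0" "\<And>x. x \<in> \<Omega> \<Longrightarrow> norm x \<le> R"
    using \<Omega>(2) bounded_pos by blast
  define C where "C = 4 * R\<^sup>2"
  have "L2_inner \<Omega> u u \<le> (4 * C) * dirichlet \<Omega> u" if u: "u \<in> W12_0 \<Omega>" for u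
  proof -
    have W: "u \<in> W12 \<Omega>" using u by (simp add: W12_0_def)
    note uw = W12_weak_grad[OF W]
    obtain \<phi> where \<phi>: "\<And>k. \<phi> k \<in> test_functions \<Omega>"
      and a: "(\<lambda>k. L2_inner \<Omega> (\<lambda>x. u x - \<phi> k x) (\<lambda>x. u x - \<phi> k x)) \<longlonglongrightarrow> 0"
      and b: "(\<lambda>k. L2_inner \<Omega> (\<lambda>x. weak_grad \<Omega> u x - grad (\<phi> k) x)
           (\<lambda>x. weak_grad \<Omega> u x - grad (\<phi> k) x)) \<longlonglongrightarrow> 0"
      using W12_0_approx[OF \<Omega> u] by blast
    let ?a = "\<lambda>k. L2_inner \<Omega> (\<lambda>x. u x - \<phi> k x) (\<lambda>x. u x - \<phi> k x)"
    let ?b = "\<lambda>k. L2_inner \<Omega> (\<lambda>x. weak_grad \<Omega> u x - grad (\<phi> k) x) (\<lambda>x. weak_grad \<Omega> u x - grad (\<phi> k) x)"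
    note s = smooth_imp_L2[OF \<Omega> test_function_smooth[OF \<phi>]]
    have "L2_inner \<Omega> u u \<le> 2 * ?a k + 2 * (C * (2 * ?b k + 2 * dirichlet \<Omega> u))" for k
    proof -
      have "L2_inner \<Omega> (grad (\<phi> k)) (grad (\<phi> k)) \<le> 2 * ?b k + 2 * dirichlet \<Omega> u"
        using L2_inner_self_le[OF s(2)[of k] uw(2)]
        by (simp add: dirichlet_def L2_inner_def inner_diff inner_commute algebra_simps)
      then have "C * L2_inner \<Omega> (grad (\<phi> k)) (grad (\<phi> k)) \<le> C * (2 * ?b k + 2 * dirichlet \<Omega> u)"
        by (intro mult_left_mono) (simp_all add: C_def)
      moreover have "L2_inner \<Omega> (\<phi> k) (\<phi> k) \<le> C * L2_inner \<Omega> (grad (\<phi> k)) (grad (\<phi> k))"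
        unfolding C_def by (rule Poincare_test_function[OF \<Omega> R(2) \<phi>])
      ultimately show ?thesis
        using L2_inner_self_le[OF uw(1) s(1)[of k]] by linarith
    qed
    moreover have "(\<lambda>k. 2 * ?a k + 2 * (C * (2 * ?b k + 2 * dirichlet \<Omega> u)))
        \<longlonglongrightarrow> 2 * 0 + 2 * (C * (2 * 0 + 2 * dirichlet \<Omega> u))"
      by (intro tendsto_intros a b)
    ultimately have "L2_inner \<Omega> u u \<le> 2 * 0 + 2 * (C * (2 * 0 + 2 * dirichlet \<Omega> u))"
      by (intro LIMSEQ_le_const) auto
    then show ?thesis by simp
  qed
  moreover have "4 * C > 0" using R(1) by (simp add: C_def)
  ultimately show ?thesis using that by blast
qed

text \<open>By Poincare's inequality \<open>1 / K\<close> is a lower bound of all Rayleigh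
  quotients. It bounds the infimum only if there is a quotient at all, \<open>Inf {}\<close> being
  unspecified; a bump on a box in \<open>\<Omega>\<close> provides one, as it is positive on a set
  of positive measure.\<close>

lemma first_eigenvalue_pos:
  fixes \<Omega> :: "'a::euclidean_space set"
  assumes \<Omega>: "open \<Omega>" "bounded \<Omega>" "\<Omega> \<noteq> {}"
  shows "first_eigenvalue \<Omega> > 0"
proof -
  obtain K where K: "K > 0" "\<And>u. u \<in> W12_0 \<Omega> \<Longrightarrow> L2_inner \<Omega> u u \<le> K * dirichlet \<Omega> u"
    using Poincare_W12_0[OF \<Omega>(1,2)] by blast
  obtain p where "p \<in> \<Omega>" using \<Omega>(3) by blast
  then obtain a b where ab: "p \<in> box a b" "cbox a b \<subseteq> \<Omega>"
    using open_contains_cbox[OF \<Omega>(1)] by metis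
  have \<Omega>s: "\<Omega> \<inter> space lebesgue \<in> sets lebesgue" using \<Omega> by auto
  have ex: "bump a b 1 \<in> W12_0 \<Omega>"
    by (rule test_function_W12_0[OF \<Omega>(1,2) bump_test_function[OF ab(2)]])
  moreover have nz: "\<not> (AE x in lebesgue_on \<Omega>. bump a b 1 x = 0)"
  proof
    assume "AE x in lebesgue_on \<Omega>. bump a b 1 x = 0"
    then have "AE x in lebesgue. x \<in> \<Omega> \<longrightarrow> bump a b 1 x = 0"
      by (simp add: AE_restrict_space_iff[OF \<Omega>s])
    then have "AE x in lebesgue. x \<notin> box a b"
    proof eventually_elim
      case (elim x)
      show ?case
      proof
        assume x: "x \<in> box a b"
        then have "x \<in> \<Omega>" using ab(2) box_subset_cbox[of a b] by blast
        with elim bump_pos[OF x] show False by simp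
      qed
    qed
    then have "negligible (box a b)"
      by (simp add: negligible_iff_null_sets AE_iff_null_sets)
    then show False using ab(1) negligible_interval(2)[of a b] by blast
  qed
  ultimately have ne: "{(LINT x|lebesgue_on \<Omega>. (norm (weak_grad \<Omega> \<phi> x))\<^sup>2) / (LINT x|lebesgue_on \<Omega>. (\<phi> x)\<^sup>2) | \<phi>.
      \<phi> \<in> W12_0 \<Omega> \<and> \<not> (AE x in lebesgue_on \<Omega>. \<phi> x = 0)} \<noteq> {}"
    by blast
  have "1 / K \<le> first_eigenvalue \<Omega>"
    unfolding first_eigenvalue_def
  proof (rule cInf_greatest[OF ne], clarsimp)
    fix \<phi> assume \<phi>: "\<phi> \<in> W12_0 \<Omega>" "\<not> (AE x in lebesgue_on \<Omega>. \<phi> x = 0)"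
    have "\<phi> \<in> L2 \<Omega>" using \<phi> by (auto simp: W12_0_def W12_def)
    then have "L2_inner \<Omega> \<phi> \<phi> \<noteq> 0" using \<phi>(2) L2_inner_self_eq_0D by blast
    then have "L2_inner \<Omega> \<phi> \<phi> > 0" using L2_inner_nonneg[of \<Omega> \<phi>] by linarith
    then have "1 / K \<le> dirichlet \<Omega> \<phi> / L2_inner \<Omega> \<phi> \<phi>"
      using K(1) K(2)[OF \<phi>(1)] by (simp add: field_simps)
    then show "1 / K \<le> (LINT x|lebesgue_on \<Omega>. (norm (weak_grad \<Omega> \<phi> x))\<^sup>2) / (LINT x|lebesgue_on \<Omega>. (\<phi> x)\<^sup>2)"
      by (simp add: dirichlet_def L2_inner_def power2_norm_eq_inner) (simp add: power2_eq_square)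
  qed
  moreover have "1 / K > 0" using K by simp
  ultimately show ?thesis by linarith
qed

subsection \<open>Energy estimates\<close>

text \<open>Both sides are continuous in \<open>w\<close> for the \<open>W12\<close> norm by
  Cauchy-Schwarz, and test functions are dense in \<open>W12_0\<close> by definition.\<close>

lemma weak_laplacian_test_W12_0:
  assumes \<Omega>: "open \<Omega>" "bounded \<Omega>" and u: "u \<in> W12 \<Omega>" and f: "f \<in> L2 \<Omega>"
    and eq: "weak_laplacian \<Omega> u f" and w: "w \<in> W12_0 \<Omega>"
  shows "L2_inner \<Omega> (weak_grad \<Omega> w) (weak_grad \<Omega> u) = - L2_inner \<Omega> w f"
proof -
  have W: "w \<in> W12 \<Omega>" using w by (simp add: W12_0_def)
  obtain \<phi> where \<phi>: "\<And>k. \<phi> k \<in> test_functions \<Omega>"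
    and a: "(\<lambda>k. L2_inner \<Omega> (\<lambda>x. w x - \<phi> k x) (\<lambda>x. w x - \<phi> k x)) \<longlonglongrightarrow> 0"
    and b: "(\<lambda>k. L2_inner \<Omega> (\<lambda>x. weak_grad \<Omega> w x - grad (\<phi> k) x)
         (\<lambda>x. weak_grad \<Omega> w x - grad (\<phi> k) x)) \<longlonglongrightarrow> 0"
    using W12_0_approx[OF \<Omega> w] by blast
  note s = smooth_imp_L2[OF \<Omega> test_function_smooth[OF \<phi>]]
  have "L2_inner \<Omega> (grad (\<phi> k)) (weak_grad \<Omega> u) = - L2_inner \<Omega> (\<phi> k) f" for k
    using eq \<phi>[of k] unfolding weak_laplacian_def L2_inner_def
    by (fastforce simp: grad_inner smooth_on_differentiable[OF test_function_smooth[OF \<phi>]] mult.commute)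
  moreover have "(\<lambda>k. L2_inner \<Omega> (grad (\<phi> k)) (weak_grad \<Omega> u)) \<longlonglongrightarrow> L2_inner \<Omega> (weak_grad \<Omega> w) (weak_grad \<Omega> u)"
    by (intro L2_inner_tendsto_left s W12_weak_grad W u b)
  moreover have "(\<lambda>k. - L2_inner \<Omega> (\<phi> k) f) \<longlonglongrightarrow> - L2_inner \<Omega> w f"
    by (intro tendsto_minus L2_inner_tendsto_left s W12_weak_grad W f a)
  ultimately show ?thesis
    using LIMSEQ_unique by simp
qed

text \<open>Both equations are tested with \<open>u - u'\<close> and subtracted.\<close>

lemma dirichlet_diff_eq:
  assumes \<Omega>: "open \<Omega>" "bounded \<Omega>" and u: "u \<in> W12 \<Omega>" "u' \<in> W12 \<Omega>" and f: "f \<in> L2 \<Omega>" "f' \<in> L2 \<Omega>"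
    and eq: "weak_laplacian \<Omega> u f" "weak_laplacian \<Omega> u' f'" and w: "(\<lambda>x. u x - u' x) \<in> W12_0 \<Omega>"
  shows "dirichlet \<Omega> (\<lambda>x. u x - u' x) = - L2_inner \<Omega> (\<lambda>x. f x - f' x) (\<lambda>x. u x - u' x)"
proof -
  let ?w = "\<lambda>x. u x - u' x"
  have W: "?w \<in> W12 \<Omega>" using w by (simp add: W12_0_def)
  note uw = W12_weak_grad[OF u(1)] and u'w = W12_weak_grad[OF u(2)] and ww = W12_weak_grad[OF W]
  have "dirichlet \<Omega> ?w = L2_inner \<Omega> (\<lambda>x. weak_grad \<Omega> u x - weak_grad \<Omega> u' x) (weak_grad \<Omega> ?w)"
    unfolding dirichlet_def
    by (intro L2_inner_cong_AE ww L2_diff uw u'w W12_diff(2)[OF \<Omega> u]) auto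
  also have "\<dots> = L2_inner \<Omega> (weak_grad \<Omega> ?w) (weak_grad \<Omega> u) - L2_inner \<Omega> (weak_grad \<Omega> ?w) (weak_grad \<Omega> u')"
    using L2_inner_diff_left[OF uw(2) u'w(2) ww(2)] by (simp add: L2_inner_commute[of _ "weak_grad \<Omega> ?w"])
  also have "\<dots> = - (L2_inner \<Omega> f ?w - L2_inner \<Omega> f' ?w)"
    using weak_laplacian_test_W12_0[OF \<Omega> u(1) f(1) eq(1) w] weak_laplacian_test_W12_0[OF \<Omega> u(2) f(2) eq(2) w]
    by (simp add: L2_inner_commute[of _ ?w])
  also have "\<dots> = - L2_inner \<Omega> (\<lambda>x. f x - f' x) ?w"
    by (simp add: L2_inner_diff_left f ww)
  finally show ?thesis .
qed

text \<open>The difference of the right-hand sides is \<open>c - c'\<close> plus the coupling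
  \<open>l * p * c\<close>, where \<open>c\<close> and \<open>c'\<close> are the two indicators.
  Against \<open>u - u'\<close> the first part has a favourable sign, and Young's inequality bounds
  the second. In the system \<open>p\<close> is the other component; with \<open>l = 0\<close> the
  bound is zero and yields uniqueness.\<close>

lemma obstacle_perturbation:
  assumes \<Omega>: "open \<Omega>" "bounded \<Omega>" and u: "u \<in> W12 \<Omega>" "u' \<in> W12 \<Omega>" and p: "p \<in> L2 \<Omega>"
    and eq: "weak_laplacian \<Omega> u (\<lambda>x. (1 + l * p x) * indicator {y. u y > 0} x)"
      "weak_laplacian \<Omega> u' (indicator {y. u' y > 0})"
    and nonneg: "AE x in lebesgue_on \<Omega>. u x \<ge> 0" "AE x in lebesgue_on \<Omega>. u' x \<ge> 0"
    and w: "(\<lambda>x. u x - u' x) \<in> W12_0 \<Omega>"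
  shows "dirichlet \<Omega> (\<lambda>x. u x - u' x)
    \<le> \<bar>l\<bar> / 2 * (L2_inner \<Omega> p p + L2_inner \<Omega> (\<lambda>x. u x - u' x) (\<lambda>x. u x - u' x))"
proof -
  let ?w = "\<lambda>x. u x - u' x"
  let ?f = "\<lambda>x. (1 + l * p x) * indicator {y. u y > 0} x" and ?f' = "indicator {y. u' y > 0}"
  have wL: "?w \<in> L2 \<Omega>" by (intro L2_diff W12_weak_grad u)
  have ind: "indicator {y. v y > 0} \<in> borel_measurable (lebesgue_on \<Omega>)" if "v \<in> W12 \<Omega>" for v :: "'a \<Rightarrow> real"
  proof -
    have [measurable]: "v \<in> borel_measurable (lebesgue_on \<Omega>)"
      by (intro L2_measurable W12_weak_grad that)
    have "(indicator {y. v y > 0} :: 'a \<Rightarrow> real) = (\<lambda>x. if v x > 0 then 1 else 0)"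
      by (auto simp: indicator_def)
    then show ?thesis by simp
  qed
  \<comment> \<open>Constants are square integrable because \<open>\<Omega>\<close> is bounded;
    hence so is \<open>1 + l * p\<close>, which dominates the first right-hand side.\<close>
  have one: "(\<lambda>x. 1) \<in> L2 \<Omega>" by (intro continuous_imp_L2 \<Omega> continuous_intros)
  have f: "?f \<in> L2 \<Omega>"
  proof (rule L2_bounded_by)
    show "(\<lambda>x. 1 + l *\<^sub>R p x) \<in> L2 \<Omega>" by (intro L2_add L2_scaleR one p)
    show "?f \<in> borel_measurable (lebesgue_on \<Omega>)"
      by (intro borel_measurable_times borel_measurable_add borel_measurable_const
          ind[OF u(1)] L2_measurable[OF p])
  qed (auto simp: indicator_def)
  have f': "?f' \<in> L2 \<Omega>"
    by (rule L2_bounded_by[OF one ind[OF u(2)]]) (auto simp: indicator_def)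
  have "dirichlet \<Omega> ?w = (LINT x|lebesgue_on \<Omega>. - ((?f x - ?f' x) * ?w x))"
    using dirichlet_diff_eq[OF \<Omega> u f f' eq w] by (simp add: L2_inner_def)
  also have "\<dots> \<le> (LINT x|lebesgue_on \<Omega>. \<bar>l\<bar> / 2 * (p x * p x + ?w x * ?w x))"
  proof (rule integral_mono_AE)
    show "integrable (lebesgue_on \<Omega>) (\<lambda>x. - ((?f x - ?f' x) * ?w x))"
      using L2_integrable_inner[OF L2_diff[OF f f'] wL] by simp
    show "integrable (lebesgue_on \<Omega>) (\<lambda>x. \<bar>l\<bar> / 2 * (p x * p x + ?w x * ?w x))"
      using L2_integrable_inner[OF p p] L2_integrable_inner[OF wL wL]
      by (intro integrable_mult_right Bochner_Integration.integrable_add) simp_all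
    show "AE x in lebesgue_on \<Omega>. - ((?f x - ?f' x) * ?w x) \<le> \<bar>l\<bar> / 2 * (p x * p x + ?w x * ?w x)"
      using nonneg
    proof eventually_elim
      case (elim x)
      define c :: real where "c = indicator {y. u y > 0} x"
      define c' :: real where "c' = indicator {y. u' y > 0} x"
      \<comment> \<open>Where the indicators differ, one function is positive and the other, being
        nonnegative, is zero; so \<open>u - u'\<close> has the sign of
        \<open>c - c'\<close>.\<close>
      have "0 \<le> (c - c') * ?w x"
        using elim by (auto simp: c_def c'_def indicator_def)
      moreover have "- (l * p x * c * ?w x) \<le> \<bar>l\<bar> / 2 * (p x * p x + ?w x * ?w x)"
      proof -
        have "- (l * p x * c * ?w x) \<le> \<bar>l * p x * c * ?w x\<bar>" by linarith
        also have "\<dots> = \<bar>l\<bar> * (\<bar>p x * ?w x\<bar> * c)" by (simp add: abs_mult c_def)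
        also have "\<dots> \<le> \<bar>l\<bar> * ((p x * p x + ?w x * ?w x) / 2)"
        proof (rule mult_left_mono)
          have "\<bar>p x * ?w x\<bar> * c \<le> \<bar>p x\<bar> * \<bar>?w x\<bar>" by (simp add: c_def indicator_def abs_mult)
          also have "\<dots> \<le> (p x * p x + ?w x * ?w x) / 2"
            using sum_squares_bound[of "\<bar>p x\<bar>" "\<bar>?w x\<bar>"] by (simp add: power2_eq_square)
          finally show "\<bar>p x * ?w x\<bar> * c \<le> (p x * p x + ?w x * ?w x) / 2" .
        qed simp
        finally show ?thesis by simp
      qed
      ultimately show ?case
        unfolding c_def[symmetric] c'_def[symmetric] by (simp add: algebra_simps)
    qed
  qed
  also have "\<dots> = \<bar>l\<bar> / 2 * (L2_inner \<Omega> p p + L2_inner \<Omega> ?w ?w)"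
    using L2_integrable_inner[OF p p] L2_integrable_inner[OF wL wL]
    by (simp add: L2_inner_def)
  finally show ?thesis .
qed

lemma W12_0_diff_of_boundary_values:
  assumes "open \<Omega>" "bounded \<Omega>" "(\<lambda>x. u x - g x) \<in> W12_0 \<Omega>" "(\<lambda>x. v x - g x) \<in> W12_0 \<Omega>"
  shows "(\<lambda>x. u x - v x) \<in> W12_0 \<Omega>"
  using W12_0_diff[OF assms] by simp

lemma solves_obstacle_unique:
  assumes \<Omega>: "open \<Omega>" "bounded \<Omega>" and u: "solves_obstacle \<Omega> g u"
  shows "is_the_obstacle_solution \<Omega> g u"
  unfolding is_the_obstacle_solution_def
proof (intro conjI allI impI u)
  fix w assume w: "solves_obstacle \<Omega> g w"
  obtain K where K: "\<And>u. u \<in> W12_0 \<Omega> \<Longrightarrow> L2_inner \<Omega> u u \<le> K * dirichlet \<Omega> u"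
    using Poincare_W12_0[OF \<Omega>] by blast
  have d: "(\<lambda>x. w x - u x) \<in> W12_0 \<Omega>"
    by (rule W12_0_diff_of_boundary_values[OF \<Omega>, where g = g])
      (use u w in \<open>simp_all add: solves_obstacle_def\<close>)
  have "(\<lambda>x. 0) \<in> L2 \<Omega>" by (simp add: L2_def)
  \<comment> \<open>Both equations are the unperturbed one, so the estimate is used with
    \<open>p = 0\<close> and \<open>l = 0\<close>; Poincare's inequality then upgrades zero energy
    to equality almost everywhere.\<close>
  then have "dirichlet \<Omega> (\<lambda>x. w x - u x) \<le> 0"
    using obstacle_perturbation[OF \<Omega>, of w u "\<lambda>x. 0" 0] u w d by (simp add: solves_obstacle_def)
  then have "dirichlet \<Omega> (\<lambda>x. w x - u x) = 0"
    using dirichlet_nonneg[of \<Omega>] by (rule antisym)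
  then have "L2_inner \<Omega> (\<lambda>x. w x - u x) (\<lambda>x. w x - u x) = 0"
    using K[OF d] L2_inner_nonneg[of \<Omega> "\<lambda>x. w x - u x"] by simp
  moreover have "(\<lambda>x. w x - u x) \<in> L2 \<Omega>"
    using d by (simp add: W12_0_def W12_def)
  ultimately have "AE x in lebesgue_on \<Omega>. w x - u x = 0"
    by (intro L2_inner_self_eq_0D)
  then show "AE x in lebesgue_on \<Omega>. w x = u x" by simp
qed

lemma solves_system_0_imp_obstacle:
  assumes "solves_system \<Omega> g\<^sub>1 g\<^sub>2 0 u v"
  shows "solves_obstacle \<Omega> g\<^sub>1 u" "solves_obstacle \<Omega> g\<^sub>2 v"
  using assms by (simp_all add: solves_system_def solves_obstacle_def)

text \<open>In the bound for one component the other enters through its full norm. Splitting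
  \<open>v = (v - v') + v'\<close> costs \<open>2 * K\<close> times the energy of
  \<open>v - v'\<close>, and the difference \<open>u - u'\<close> itself costs \<open>K\<close>
  times its own energy; the symmetric bound does the same, whence the constant 3.\<close>

lemma solves_system_dirichlet_le:
  assumes \<Omega>: "open \<Omega>" "bounded \<Omega>"
    and K: "\<And>w. w \<in> W12_0 \<Omega> \<Longrightarrow> L2_inner \<Omega> w w \<le> K * dirichlet \<Omega> w" and l: "3 * K * \<bar>l\<bar> \<le> 1"
    and S: "solves_system \<Omega> g\<^sub>1 g\<^sub>2 l u v" and S0: "solves_system \<Omega> g\<^sub>1 g\<^sub>2 0 u' v'"
  shows "dirichlet \<Omega> (\<lambda>x. u x - u' x) + dirichlet \<Omega> (\<lambda>x. v x - v' x)
    \<le> 2 * \<bar>l\<bar> * (L2_inner \<Omega> u' u' + L2_inner \<Omega> v' v')"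
proof -
  note O = solves_system_0_imp_obstacle[OF S0]
  let ?w = "\<lambda>x. u x - u' x" and ?z = "\<lambda>x. v x - v' x"
  have W: "u \<in> W12 \<Omega>" "v \<in> W12 \<Omega>" "u' \<in> W12 \<Omega>" "v' \<in> W12 \<Omega>"
    using S S0 by (auto simp: solves_system_def)
  note L = W[THEN W12_weak_grad(1)]
  have w: "?w \<in> W12_0 \<Omega>" "?z \<in> W12_0 \<Omega>"
    using S S0 W12_0_diff_of_boundary_values[OF \<Omega>] unfolding solves_system_def by blast+
  have "dirichlet \<Omega> ?w \<le> \<bar>l\<bar> / 2 * (L2_inner \<Omega> v v + L2_inner \<Omega> ?w ?w)"
    using S O(1) by (intro obstacle_perturbation[OF \<Omega> W(1,3) L(2) _ _ _ _ w(1)])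
      (auto simp: solves_system_def solves_obstacle_def)
  also have "\<dots> \<le> \<bar>l\<bar> / 2 * ((2 * (K * dirichlet \<Omega> ?z) + 2 * L2_inner \<Omega> v' v') + K * dirichlet \<Omega> ?w)"
    using L2_inner_self_le[OF L(2,4)] K[OF w(1)] K[OF w(2)] by (intro mult_left_mono) auto
  finally have A: "dirichlet \<Omega> ?w \<le> \<dots>" .
  have "dirichlet \<Omega> ?z \<le> \<bar>l\<bar> / 2 * (L2_inner \<Omega> u u + L2_inner \<Omega> ?z ?z)"
    using S O(2) by (intro obstacle_perturbation[OF \<Omega> W(2,4) L(1) _ _ _ _ w(2)])
      (auto simp: solves_system_def solves_obstacle_def)
  also have "\<dots> \<le> \<bar>l\<bar> / 2 * ((2 * (K * dirichlet \<Omega> ?w) + 2 * L2_inner \<Omega> u' u') + K * dirichlet \<Omega> ?z)"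
    using L2_inner_self_le[OF L(1,3)] K[OF w(1)] K[OF w(2)] by (intro mult_left_mono) auto
  finally have B: "dirichlet \<Omega> ?z \<le> \<dots>" .
  define D where "D = dirichlet \<Omega> ?w + dirichlet \<Omega> ?z"
  have "D \<le> \<bar>l\<bar> * (L2_inner \<Omega> u' u' + L2_inner \<Omega> v' v') + (3 * K * \<bar>l\<bar>) * D / 2"
    using add_mono[OF A B] unfolding D_def by (rule order_trans) (simp add: field_simps)
  \<comment> \<open>The smallness condition makes the energy on the right at most
    \<open>D / 2\<close>; absorbing it doubles the remaining term.\<close>
  moreover have "(3 * K * \<bar>l\<bar>) * D \<le> 1 * D"
    using l by (intro mult_right_mono) (simp_all add: D_def dirichlet_nonneg)
  ultimately show ?thesis
    unfolding D_def[symmetric] by simp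
qed

theorem theorem1p6:
  fixes \<Omega> :: "(real ^ 'n) set"
    and g\<^sub>1 g\<^sub>2 :: "real ^ 'n \<Rightarrow> real"
    and u v :: "real \<Rightarrow> real ^ 'n \<Rightarrow> real"
  assumes "smooth_bounded_domain \<Omega>"
    and "admissible_data \<Omega> g\<^sub>1" and "admissible_data \<Omega> g\<^sub>2"
    and "\<And>l. l > - first_eigenvalue \<Omega> \<Longrightarrow> solves_system \<Omega> g\<^sub>1 g\<^sub>2 l (u l) (v l)"
  shows "\<exists>(l :: nat \<Rightarrow> real). \<exists>u\<^sub>0 \<in> W12 \<Omega>. \<exists>v\<^sub>0 \<in> W12 \<Omega>.
           (\<forall>k. l k > - first_eigenvalue \<Omega> \<and> l k \<noteq> 0) \<and> l \<longlonglongrightarrow> 0 \<and>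
           (\<lambda>k. W12_norm \<Omega> (\<lambda>x. u (l k) x - u\<^sub>0 x)) \<longlonglongrightarrow> 0 \<and>
           (\<lambda>k. W12_norm \<Omega> (\<lambda>x. v (l k) x - v\<^sub>0 x)) \<longlonglongrightarrow> 0 \<and>
           is_the_obstacle_solution \<Omega> g\<^sub>1 u\<^sub>0 \<and> is_the_obstacle_solution \<Omega> g\<^sub>2 v\<^sub>0"
proof -
  have \<Omega>: "open \<Omega>" "bounded \<Omega>" "\<Omega> \<noteq> {}"
    using assms(1) by (auto simp: smooth_bounded_domain_def)
  note pos = first_eigenvalue_pos[OF \<Omega>]
  \<comment> \<open>Positivity of the first eigenvalue admits \<open>l = 0\<close>, which supplies
    the limit pair, together with every positive parameter.\<close>
  have S: "solves_system \<Omega> g\<^sub>1 g\<^sub>2 l (u l) (v l)" if "l \<ge> 0" for l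
    using pos that by (intro assms(4)) linarith
  obtain K where K: "K > 0" "\<And>w. w \<in> W12_0 \<Omega> \<Longrightarrow> L2_inner \<Omega> w w \<le> K * dirichlet \<Omega> w"
    using Poincare_W12_0[OF \<Omega>(1,2)] by blast
  \<comment> \<open>Positive, hence nonzero and admissible, and scaled so that
    \<open>3 * K * \<bar>l k\<bar> \<le> 1\<close> holds for every index and not merely
    eventually.\<close>
  define l where "l k = inverse (real (Suc k)) / (3 * K)" for k
  have l_pos: "l k > 0" for k using K(1) by (simp add: l_def)
  have "3 * K * \<bar>l k\<bar> = inverse (real (Suc k))" for k using K(1) by (simp add: l_def)
  then have l_small: "3 * K * \<bar>l k\<bar> \<le> 1" for k by (simp add: inverse_le_1_iff)
  have l_lim: "l \<longlonglongrightarrow> 0"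
    unfolding l_def using tendsto_divide[OF LIMSEQ_inverse_real_of_nat tendsto_const[of "3 * K"]] K(1)
    by simp
  define c where "c = L2_inner \<Omega> (u 0) (u 0) + L2_inner \<Omega> (v 0) (v 0)"
  have bound: "dirichlet \<Omega> (\<lambda>x. u (l k) x - u 0 x) + dirichlet \<Omega> (\<lambda>x. v (l k) x - v 0 x) \<le> 2 * \<bar>l k\<bar> * c" for k
    unfolding c_def
    by (rule solves_system_dirichlet_le[OF \<Omega>(1,2) K(2) l_small S S]) (simp_all add: l_pos less_imp_le)
  \<comment> \<open>The energies are squeezed to 0 by the linear bound in \<open>l k\<close>, and
    Poincare's inequality takes the function part along. Either component satisfies the bound
    because the energy of the other is nonnegative.\<close>
  have conv: "(\<lambda>k. W12_norm \<Omega> (w k)) \<longlonglongrightarrow> 0"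
    if w: "\<And>k. w k \<in> W12_0 \<Omega>" and le: "\<And>k. dirichlet \<Omega> (w k) \<le> 2 * \<bar>l k\<bar> * c"
    for w :: "nat \<Rightarrow> real ^ 'n \<Rightarrow> real"
  proof -
    have "(\<lambda>k. 2 * \<bar>l k\<bar> * c) \<longlonglongrightarrow> 2 * \<bar>0\<bar> * c"
      by (intro tendsto_intros l_lim)
    then have lim: "(\<lambda>k. 2 * \<bar>l k\<bar> * c) \<longlonglongrightarrow> 0" by simp
    have D: "(\<lambda>k. dirichlet \<Omega> (w k)) \<longlonglongrightarrow> 0"
      by (rule tendsto_sandwich[OF _ _ tendsto_const lim]) (simp_all add: dirichlet_nonneg le)
    have "(\<lambda>k. L2_inner \<Omega> (w k) (w k)) \<longlonglongrightarrow> 0"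
      by (rule tendsto_sandwich[OF _ _ tendsto_const tendsto_mult_right_zero[OF D, of K]])
        (simp_all add: L2_inner_nonneg K(2)[OF w])
    with D show ?thesis by (simp add: W12_norm_tendsto_0_iff)
  qed
  have W: "(\<lambda>x. u (l k) x - u 0 x) \<in> W12_0 \<Omega>" "(\<lambda>x. v (l k) x - v 0 x) \<in> W12_0 \<Omega>" for k
    using S[of "l k"] S[of 0] l_pos[of k] W12_0_diff_of_boundary_values[OF \<Omega>(1,2)]
    unfolding solves_system_def by (simp_all add: less_imp_le) blast+
  have "(\<lambda>k. W12_norm \<Omega> (\<lambda>x. u (l k) x - u 0 x)) \<longlonglongrightarrow> 0"
    using bound dirichlet_nonneg[of \<Omega>] by (intro conv W) (smt (verit))
  moreover have "(\<lambda>k. W12_norm \<Omega> (\<lambda>x. v (l k) x - v 0 x)) \<longlonglongrightarrow> 0"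
    using bound dirichlet_nonneg[of \<Omega>] by (intro conv W) (smt (verit))
  moreover have "l k > - first_eigenvalue \<Omega> \<and> l k \<noteq> 0" for k
    using l_pos[of k] pos by linarith
  moreover have "u 0 \<in> W12 \<Omega>" "v 0 \<in> W12 \<Omega>"
    using S[of 0] by (auto simp: solves_system_def)
  moreover have "is_the_obstacle_solution \<Omega> g\<^sub>1 (u 0)" "is_the_obstacle_solution \<Omega> g\<^sub>2 (v 0)"
    using solves_system_0_imp_obstacle[OF S[of 0]] by (simp_all add: solves_obstacle_unique[OF \<Omega>(1,2)])
  ultimately show ?thesis
    using l_lim by blast
qed

end
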